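(* Let $n\ge3$, let $M$ be a locally strongly convex hypersurface in $\mathbb{A}^{n+1}$, and suppose that at every point $x$ of $M$ the affine shape operator $\mathcal{S}_x$ has three distinct affine principal curvatures $\lambda_0$, $\lambda_1$ and $\lambda_2$, with multiplicities $1$, $n_1$ and $n_2$, respectively. Put $\alpha=\lambda_0+\lambda_1+\lambda_2$, $\beta=-\lambda_0(\lambda_1+\lambda_2)-\lambda_1\lambda_2$, $\gamma=\lambda_0\lambda_1\lambda_2$, and define the tensor $A$ and the function $\mu$ on $M$ by $$A=(\mathrm{Ric}(R^{\ast}))^{2}+\bigl((\alpha-\mathrm{tr}_h(\mathcal{S}))^{2}+\beta\bigr)\mathrm{Ric}(R^{\ast})-\gamma\,(\alpha-2\,\mathrm{tr}_h(\mathcal{S}))\,h,$$ $$\mu=\gamma+(\alpha-\mathrm{tr}_h(\mathcal{S}))\bigl(\beta+\mathrm{tr}_h(\mathcal{S})(\alpha-\mathrm{tr}_h(\mathcal{S}))\bigr).$$ Then on $M$ $$A=\mu\,S$$ and $$\mu=\bigl(\lambda_0+(n_1-1)\lambda_1+(n_2-1)\lambda_2\bigr)\Bigl(\lambda_1\lambda_2+(n_1\lambda_1+n_2\lambda_2)\bigl((n_1-1)\lambda_1+(n_2-1)\lambda_2\bigr)\Bigr).$$ Moreover: (i) if $\mu$ vanishes at a point $x\in M$, then $M$ is affine partially Einstein$^{\ast}$ at this point; (ii) if $\mu$ is non-zero at a point $x\in M$, then $$R^{\ast}=\frac{1}{2\mu^{2}}\,A\wedge A$$ holds on some neighbourhood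 $U\subset M$ of this point.
   Context: $\mathbb{A}^{n+1}$ is $\mathbb{R}^{n+1}$ with its standard flat connection and the volume form given by the determinant. A hypersurface $M\subset\mathbb{A}^{n+1}$ (connected, smooth) is non-degenerate if its affine fundamental form is non-degenerate; it then carries its affine normal $\xi$, the Blaschke-Berwald metric $h$, the induced connection $\nabla$ and the affine shape operator $\mathcal{S}$ (Gauss and Weingarten formulas $\widetilde\nabla_XY=\nabla_XY+h(X,Y)\xi$, $\widetilde\nabla_X\xi=-\mathcal{S}X$); the operator $\mathcal{S}$ is $h$-self-adjoint. For a locally strongly convex hypersurface $h$ is positive definite, and the (real) eigenvalues of $\mathcal{S}_x$ are called the affine principal curvatures at $x$. Set $S(X,Y)=h(X,\mathcal{S}Y)$; $\mathrm{tr}_h(\mathcal{S})$ is the trace of $\mathcal{S}$. For a symmetric $(0,2)$-tensor $E$ with associated endomorphism $\mathcal{E}$, $h(\mathcal{E}X,Y)=E(X,Y)$, put $E^{2}(X,Y)=E(\mathcal{E}X,Y)$. For symmetric $(0,2)$-tensors $E,F$ the Kulkarni-Nomizu product is $(E\wedge F)(X_1,X_2,X_3,X_4)=E(X_1,X_4)F(X_2,X_3)+E(X_2,X_3)F(X_1,X_4)-E(X_1,X_3)F(X_2,X_4)-E(X_2,X_4)F(X_1,X_3)$. The Opozda-Verstraelen affine curvature tensor is $R^{\ast}=\frac12 S\wedge S$, with Ricci tensor $\mathrm{Ric}(R^{\ast})(X,Y)=\sum_jR^{\ast}(e_j,X,Y,e_j)$, $(e_j)$ an $h$-orthonormal basis.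 $M$ is called affine partially Einstein$^{\ast}$ at $x\in M$ if at $x$ one has $(\mathrm{Ric}(R^{\ast}))^{2}=\rho_1\,\mathrm{Ric}(R^{\ast})+\rho_2\,h$ for some $\rho_1,\rho_2\in\mathbb{R}$. *)

theory Defs
  imports "HOL-Analysis.Analysis"
begin

text \<open>
  The ambient space of dimension n+1 is \<open>real ^ ('n option)\<close> with \<open>n = CARD('n)\<close>.  Its volume form is
  \<open>det\<close>, and an n-tuple of tangent vectors is a function on \<open>'n\<close>; the extra index \<open>None\<close> is used for
  the transversal vector.
\<close>

primrec Ck_on :: "nat \<Rightarrow> 'a::euclidean_space set \<Rightarrow> ('a \<Rightarrow> 'b::real_normed_vector) \<Rightarrow> bool" where
  "Ck_on 0 U f \<longleftrightarrow> continuous_on U f"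
| "Ck_on (Suc k) U f \<longleftrightarrow>
     (\<forall>x\<in>U. f differentiable (at x)) \<and> (\<forall>v. Ck_on k U (\<lambda>x. frechet_derivative f (at x) v))"

definition smooth_on :: "'a::euclidean_space set \<Rightarrow> ('a \<Rightarrow> 'b::real_normed_vector) \<Rightarrow> bool" where
  "smooth_on U f \<longleftrightarrow> open U \<and> (\<forall>k. Ck_on k U f)"

definition local_param ::
    "(real ^ ('n::finite option)) set \<Rightarrow> (real ^ 'n) set \<Rightarrow> (real ^ 'n \<Rightarrow> real ^ ('n option)) \<Rightarrow> bool" where
  "local_param M \<Omega> \<phi> \<longleftrightarrow>
     smooth_on \<Omega> \<phi> \<and>
     (\<forall>u\<in>\<Omega>. inj (frechet_derivative \<phi> (at u))) \<and>
     \<phi> ` \<Omega> \<subseteq> M \<and> openin (top_of_set M) (\<phi> ` \<Omega>) \<and>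
     (\<exists>\<psi>. homeomorphism \<Omega> (\<phi> ` \<Omega>) \<phi> \<psi>)"

definition hypersurface :: "(real ^ ('n::finite option)) set \<Rightarrow> bool" where
  "hypersurface M \<longleftrightarrow> connected M \<and> (\<forall>x\<in>M. \<exists>\<Omega> \<phi>. local_param M \<Omega> \<phi> \<and> x \<in> \<phi> ` \<Omega>)"

definition tangent_space ::
    "(real ^ ('n::finite option)) set \<Rightarrow> real ^ ('n option) \<Rightarrow> (real ^ ('n option)) set" where
  "tangent_space M x =
     {v. \<exists>\<Omega> \<phi> u w. local_param M \<Omega> \<phi> \<and> u \<in> \<Omega> \<and> \<phi> u = x \<and> v = frechet_derivative \<phi> (at u) w}"

text \<open>Smoothness of a vector-valued map along a hypersurface \<open>U\<close> (for instance a relatively open subset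
  of a given hypersurface), tested in all parametrizations.\<close>

definition smooth_along ::
    "(real ^ ('n::finite option)) set \<Rightarrow> (real ^ ('n option) \<Rightarrow> 'b::real_normed_vector) \<Rightarrow> bool" where
  "smooth_along U Y \<longleftrightarrow> (\<forall>\<Omega> \<phi>. local_param U \<Omega> \<phi> \<longrightarrow> smooth_on \<Omega> (Y \<circ> \<phi>))"

text \<open>The standard flat connection applied to a vector field \<open>Y\<close> along \<open>M\<close>.  The derivative within \<open>M\<close> is
  unique only on the tangent space, so \<open>v\<close> must be tangent to \<open>M\<close> at \<open>x\<close>.\<close>

definition flat_deriv ::
    "(real ^ ('n::finite option)) set \<Rightarrow> (real ^ ('n option) \<Rightarrow> real ^ ('n option)) \<Rightarrow>
     real ^ ('n option) \<Rightarrow> real ^ ('n option) \<Rightarrow> real ^ ('n option)" where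
  "flat_deriv M Y x v = frechet_derivative Y (at x within M) v"

definition local_tangent_field ::
    "(real ^ ('n::finite option)) set \<Rightarrow> (real ^ ('n option)) set \<Rightarrow>
     (real ^ ('n option) \<Rightarrow> real ^ ('n option)) \<Rightarrow> bool" where
  "local_tangent_field M U Y \<longleftrightarrow>
     openin (top_of_set M) U \<and> smooth_along U Y \<and> (\<forall>y\<in>U. Y y \<in> tangent_space M y)"

text \<open>Gauss formula: for tangent fields \<open>X\<close>, \<open>Y\<close> with values \<open>v\<close>, \<open>w\<close> at \<open>x\<close>, the derivative of \<open>Y\<close> along
  \<open>v\<close> has \<open>h(v, w)\<close> as its coefficient along the transversal vector \<open>e\<close>.  The form depends on a
  transversal field only through its value \<open>e\<close> at \<open>x\<close>.\<close>

definition affine_fundamental_form ::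
    "(real ^ ('n::finite option)) set \<Rightarrow> real ^ ('n option) \<Rightarrow> real ^ ('n option) \<Rightarrow>
     real ^ ('n option) \<Rightarrow> real ^ ('n option) \<Rightarrow> real" where
  "affine_fundamental_form M e x v w =
     (THE c. \<forall>U Y. local_tangent_field M U Y \<and> x \<in> U \<and> Y x = w \<longrightarrow>
                   flat_deriv M Y x v - c *\<^sub>R e \<in> tangent_space M x)"

definition locally_strongly_convex :: "(real ^ ('n::finite option)) set \<Rightarrow> bool" where
  "locally_strongly_convex M \<longleftrightarrow>
     (\<forall>x\<in>M. \<exists>e. e \<notin> tangent_space M x \<and>
        (\<forall>v\<in>tangent_space M x. v \<noteq> 0 \<longrightarrow> affine_fundamental_form M e x v v > 0))"

text \<open>The metric induced by a transversal field; for the affine normal it is the Blaschke-Berwald metric.\<close>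

definition blaschke_metric ::
    "(real ^ ('n::finite option)) set \<Rightarrow> (real ^ ('n option) \<Rightarrow> real ^ ('n option)) \<Rightarrow>
     real ^ ('n option) \<Rightarrow> real ^ ('n option) \<Rightarrow> real ^ ('n option) \<Rightarrow> real" where
  "blaschke_metric M \<xi> x v w = affine_fundamental_form M (\<xi> x) x v w"

text \<open>The affine normal is the transversal field, unique up to sign, which is equiaffine and whose
  induced volume form coincides with the volume form of its affine fundamental form.\<close>

definition affine_normal ::
    "(real ^ ('n::finite option)) set \<Rightarrow> (real ^ ('n option) \<Rightarrow> real ^ ('n option)) \<Rightarrow> bool" where
  "affine_normal M \<xi> \<longleftrightarrow>
     smooth_along M \<xi> \<and>
     (\<forall>x\<in>M. \<xi> x \<notin> tangent_space M x) \<and>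
     (\<forall>x\<in>M. \<forall>v\<in>tangent_space M x. flat_deriv M \<xi> x v \<in> tangent_space M x) \<and>
     (\<forall>x\<in>M. \<forall>X. (\<forall>k. X k \<in> tangent_space M x) \<longrightarrow>
        \<bar>det ((\<chi> i j. (case j of None \<Rightarrow> \<xi> x | Some k \<Rightarrow> X k) $ i) :: real ^ ('n option) ^ ('n option))\<bar>
        = sqrt \<bar>det ((\<chi> i j. blaschke_metric M \<xi> x (X i) (X j)) :: real ^ 'n ^ 'n)\<bar>)"

text \<open>Sign convention for the affine normal of a locally strongly convex hypersurface.\<close>

definition positively_oriented ::
    "(real ^ ('n::finite option)) set \<Rightarrow> (real ^ ('n option) \<Rightarrow> real ^ ('n option)) \<Rightarrow> bool" where
  "positively_oriented M \<xi> \<longleftrightarrow>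
     (\<forall>x\<in>M. \<forall>v\<in>tangent_space M x. v \<noteq> 0 \<longrightarrow> blaschke_metric M \<xi> x v v > 0)"

text \<open>Weingarten formula; an affine normal has no transversal component in its derivative.\<close>

definition shape_operator ::
    "(real ^ ('n::finite option)) set \<Rightarrow> (real ^ ('n option) \<Rightarrow> real ^ ('n option)) \<Rightarrow>
     real ^ ('n option) \<Rightarrow> real ^ ('n option) \<Rightarrow> real ^ ('n option)" where
  "shape_operator M \<xi> x v = - flat_deriv M \<xi> x v"

definition principal_curvatures ::
    "(real ^ ('n::finite option)) set \<Rightarrow> (real ^ ('n option) \<Rightarrow> real ^ ('n option)) \<Rightarrow>
     real ^ ('n option) \<Rightarrow> real set" where
  "principal_curvatures M \<xi> x =
     {l. \<exists>v\<in>tangent_space M x. v \<noteq> 0 \<and> shape_operator M \<xi> x v = l *\<^sub>R v}"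

text \<open>Geometric and algebraic multiplicities agree here, the shape operator being self-adjoint for a
  positive definite metric.\<close>

definition curvature_multiplicity ::
    "(real ^ ('n::finite option)) set \<Rightarrow> (real ^ ('n option) \<Rightarrow> real ^ ('n option)) \<Rightarrow>
     real ^ ('n option) \<Rightarrow> real \<Rightarrow> nat" where
  "curvature_multiplicity M \<xi> x l =
     dim {v \<in> tangent_space M x. shape_operator M \<xi> x v = l *\<^sub>R v}"

definition trace_on :: "'a::euclidean_space set \<Rightarrow> ('a \<Rightarrow> 'a) \<Rightarrow> real" where
  "trace_on V T =
     (let B = (SOME B. B \<subseteq> V \<and> independent B \<and> span B = V) in \<Sum>b\<in>B. representation B (T b) b)"

definition kulkarni_nomizu ::
    "('a \<Rightarrow> 'a \<Rightarrow> real) \<Rightarrow> ('a \<Rightarrow> 'a \<Rightarrow> real) \<Rightarrow> 'a \<Rightarrow> 'a \<Rightarrow> 'a \<Rightarrow> 'a \<Rightarrow> real" where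
  "kulkarni_nomizu E F X1 X2 X3 X4 =
     E X1 X4 * F X2 X3 + E X2 X3 * F X1 X4 - E X1 X3 * F X2 X4 - E X2 X4 * F X1 X3"

definition orthonormal_basis_on ::
    "'a::euclidean_space set \<Rightarrow> ('a \<Rightarrow> 'a \<Rightarrow> real) \<Rightarrow> 'a set \<Rightarrow> bool" where
  "orthonormal_basis_on V h B \<longleftrightarrow>
     B \<subseteq> V \<and> finite B \<and> span B = V \<and> (\<forall>u\<in>B. \<forall>v\<in>B. h u v = (if u = v then 1 else 0))"

definition ricci_on ::
    "'a::euclidean_space set \<Rightarrow> ('a \<Rightarrow> 'a \<Rightarrow> real) \<Rightarrow> ('a \<Rightarrow> 'a \<Rightarrow> 'a \<Rightarrow> 'a \<Rightarrow> real) \<Rightarrow> 'a \<Rightarrow> 'a \<Rightarrow> real" where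
  "ricci_on V h R X Y = (\<Sum>e\<in>(SOME B. orthonormal_basis_on V h B). R e X Y e)"

definition assoc_endo_on ::
    "'a::euclidean_space set \<Rightarrow> ('a \<Rightarrow> 'a \<Rightarrow> real) \<Rightarrow> ('a \<Rightarrow> 'a \<Rightarrow> real) \<Rightarrow> 'a \<Rightarrow> 'a" where
  "assoc_endo_on V h E X = (THE Z. Z \<in> V \<and> (\<forall>Y\<in>V. h Z Y = E X Y))"

definition tensor_square_on ::
    "'a::euclidean_space set \<Rightarrow> ('a \<Rightarrow> 'a \<Rightarrow> real) \<Rightarrow> ('a \<Rightarrow> 'a \<Rightarrow> real) \<Rightarrow> 'a \<Rightarrow> 'a \<Rightarrow> real" where
  "tensor_square_on V h E X Y = E (assoc_endo_on V h E X) Y"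

definition shape_form ::
    "(real ^ ('n::finite option)) set \<Rightarrow> (real ^ ('n option) \<Rightarrow> real ^ ('n option)) \<Rightarrow>
     real ^ ('n option) \<Rightarrow> real ^ ('n option) \<Rightarrow> real ^ ('n option) \<Rightarrow> real" where
  "shape_form M \<xi> x X Y = blaschke_metric M \<xi> x X (shape_operator M \<xi> x Y)"

definition shape_trace ::
    "(real ^ ('n::finite option)) set \<Rightarrow> (real ^ ('n option) \<Rightarrow> real ^ ('n option)) \<Rightarrow>
     real ^ ('n option) \<Rightarrow> real" where
  "shape_trace M \<xi> x = trace_on (tangent_space M x) (shape_operator M \<xi> x)"

text \<open>The Opozda-Verstraelen affine curvature tensor.\<close>

definition R_star ::
    "(real ^ ('n::finite option)) set \<Rightarrow> (real ^ ('n option) \<Rightarrow> real ^ ('n option)) \<Rightarrow>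
     real ^ ('n option) \<Rightarrow> real ^ ('n option) \<Rightarrow> real ^ ('n option) \<Rightarrow>
     real ^ ('n option) \<Rightarrow> real ^ ('n option) \<Rightarrow> real" where
  "R_star M \<xi> x X1 X2 X3 X4 =
     1 / 2 * kulkarni_nomizu (shape_form M \<xi> x) (shape_form M \<xi> x) X1 X2 X3 X4"

definition Ric_star ::
    "(real ^ ('n::finite option)) set \<Rightarrow> (real ^ ('n option) \<Rightarrow> real ^ ('n option)) \<Rightarrow>
     real ^ ('n option) \<Rightarrow> real ^ ('n option) \<Rightarrow> real ^ ('n option) \<Rightarrow> real" where
  "Ric_star M \<xi> x = ricci_on (tangent_space M x) (blaschke_metric M \<xi> x) (R_star M \<xi> x)"

definition Ric_star_square ::
    "(real ^ ('n::finite option)) set \<Rightarrow> (real ^ ('n option) \<Rightarrow> real ^ ('n option)) \<Rightarrow>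
     real ^ ('n option) \<Rightarrow> real ^ ('n option) \<Rightarrow> real ^ ('n option) \<Rightarrow> real" where
  "Ric_star_square M \<xi> x =
     tensor_square_on (tangent_space M x) (blaschke_metric M \<xi> x) (Ric_star M \<xi> x)"

definition affine_partially_Einstein_star_at ::
    "(real ^ ('n::finite option)) set \<Rightarrow> (real ^ ('n option) \<Rightarrow> real ^ ('n option)) \<Rightarrow>
     real ^ ('n option) \<Rightarrow> bool" where
  "affine_partially_Einstein_star_at M \<xi> x \<longleftrightarrow>
     (\<exists>\<rho>1 \<rho>2. \<forall>X\<in>tangent_space M x. \<forall>Y\<in>tangent_space M x.
        Ric_star_square M \<xi> x X Y = \<rho>1 * Ric_star M \<xi> x X Y + \<rho>2 * blaschke_metric M \<xi> x X Y)"

end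

theory Submission
  imports Defs
begin

text \<open>Where the shape operator \<open>T\<close> is self-adjoint with spectrum \<open>{\<lambda>\<^sub>0, \<lambda>\<^sub>1, \<lambda>\<^sub>2}\<close> it satisfies
  \<open>T\<^sup>3 = \<alpha> T\<^sup>2 + \<beta> T + \<gamma>\<close>, and the endomorphism of the Ricci tensor of \<open>R\<^sup>*\<close> is \<open>\<tau> T - T\<^sup>2\<close> with
  \<open>\<tau> = tr T\<close>; reducing its square by the cubic relation gives \<open>A = \<mu> S\<close>.  For this the flat connection is
  expressed in a parametrization \<open>\<phi>\<close> by the conormal field \<open>\<nu>\<close>, which annihilates the tangent spaces and is
  \<open>1\<close> on the affine normal \<open>\<xi>\<close>: differentiating \<open>\<nu> \<bullet> Y = 0\<close> gives \<open>h(D\<phi> a, Y) = - Y \<bullet> D\<^sub>a \<nu>\<close>.  With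
  \<open>Y = D\<^sub>b \<phi>\<close> and \<open>Y = D\<^sub>b (\<xi> \<circ> \<phi>)\<close> the symmetry of second derivatives yields the symmetry of \<open>h\<close> and
  the self-adjointness of \<open>T\<close>.\<close>

text \<open>Two obstacles shape the proof. The metric, the shape operator and the derivative within
  \<open>M\<close> are given by descriptions and choices that determine them only on tangent
  vectors. At each point they are therefore replaced by a form \<open>h\<close> and an operator
  \<open>T\<close> that are bilinear and linear on the whole ambient space and agree with them on
  the tangent space; all algebra is done for such a pair on an abstract subspace. The other obstacle
  is (ii), the only claim that is not pointwise. Once \<open>A\<close> equals \<mu> times
  \<open>S\<close>, the identity for the curvature tensor holds wherever \<mu> is non-zero, so what
  has to be shown is that \<mu> stays non-zero nearby. The functions \<open>lam0\<close>,
  \<open>lam1\<close>, \<open>lam2\<close> come without any continuity, but \<mu> is a polynomial in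
  their elementary symmetric functions and the trace, and these are shown to be continuous in a
  parametrization.\<close>

abbreviation dir_deriv ::
    "('a::euclidean_space \<Rightarrow> 'b::real_normed_vector) \<Rightarrow> 'a \<Rightarrow> 'a \<Rightarrow> 'b" where
  "dir_deriv f v \<equiv> \<lambda>x. frechet_derivative f (at x) v"

subsection \<open>Functions of class \<open>C\<^sup>k\<close>\<close>

lemma Ck_on_has_derivative:
  "Ck_on (Suc k) U f \<Longrightarrow> x \<in> U \<Longrightarrow> (f has_derivative frechet_derivative f (at x)) (at x)"
  by (simp add: frechet_derivative_works)

text \<open>\<open>frechet_derivative\<close> is a choice among all derivatives. Functions that
  agree near \<open>x\<close> have the same derivatives there, so the same one is chosen, even where
  none exists.\<close>

lemma frechet_derivative_cong_open:
  assumes "open U" "x \<in> U" "\<And>y. y \<in> U \<Longrightarrow> f y = g y"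
  shows "frechet_derivative f (at x) = frechet_derivative g (at x)"
proof -
  have "(f has_derivative D) (at x) \<longleftrightarrow> (g has_derivative D) (at x)" for D
    using assms
    by (auto intro: has_derivative_transform_within_open[of _ _ x UNIV U])
  then show ?thesis by (simp add: frechet_derivative_def)
qed

lemma Ck_on_cong:
  assumes "open U" "Ck_on k U f" "\<And>x. x \<in> U \<Longrightarrow> g x = f x"
  shows "Ck_on k U g"
  using assms(2,3)
proof (induction k arbitrary: f g)
  case 0
  then show ?case by (simp cong: continuous_on_cong)
next
  case (Suc k)
  have eq: "frechet_derivative g (at x) = frechet_derivative f (at x)" if "x \<in> U" for x
    using frechet_derivative_cong_open[OF assms(1) that] Suc.prems(2) by blast
  have "g differentiable (at x)" if "x \<in> U" for x
  proof -
    have "(g has_derivative frechet_derivative f (at x)) (at x)"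
      by (rule has_derivative_transform_within_open[OF Ck_on_has_derivative[OF Suc.prems(1) that] assms(1) that])
        (simp add: Suc.prems(2))
    then show ?thesis by (rule differentiableI)
  qed
  moreover have "Ck_on k U (dir_deriv g v)" for v
    by (rule Suc.IH[of "dir_deriv f v"]) (use Suc.prems(1) eq in auto)
  ultimately show ?case by simp
qed

text \<open>Replaces the chosen derivative by an explicit \<open>D\<close>, so that closure
  properties follow from the usual differentiation rules by induction on the order.\<close>

lemma Ck_on_SucI:
  assumes "open U" "\<And>x. x \<in> U \<Longrightarrow> (f has_derivative D x) (at x)"
    and "\<And>v. Ck_on k U (\<lambda>x. D x v)"
  shows "Ck_on (Suc k) U f"
proof -
  have "dir_deriv f v x = D x v" if "x \<in> U" for x v
    using frechet_derivative_at[OF assms(2)[OF that]] by simp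
  then show ?thesis
    using assms Ck_on_cong[OF assms(1) assms(3)] by (auto simp: differentiable_def)
qed

lemma Ck_on_Suc_D: "Ck_on (Suc k) U f \<Longrightarrow> Ck_on k U f"
proof (induction k arbitrary: f)
  case 0
  then show ?case
    by (auto intro: differentiable_imp_continuous_on differentiable_at_imp_differentiable_on)
next
  case (Suc k)
  then have "Ck_on k U (dir_deriv f v)" for v
    by (auto simp: Suc.IH)
  with Suc.prems show ?case by simp
qed

lemma Ck_on_subset: "Ck_on k U f \<Longrightarrow> V \<subseteq> U \<Longrightarrow> Ck_on k V f"
  by (induction k arbitrary: f) (auto intro: continuous_on_subset)

lemma Ck_on_const [simp]: "Ck_on k U (\<lambda>x. c)"
  by (induction k arbitrary: c) auto

lemma Ck_on_add:
  assumes "open U"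
  shows "Ck_on k U f \<Longrightarrow> Ck_on k U g \<Longrightarrow> Ck_on k U (\<lambda>x. f x + g x)"
proof (induction k arbitrary: f g)
  case (Suc k)
  show ?case
    by (rule Ck_on_SucI[OF assms],
        rule has_derivative_add[OF Ck_on_has_derivative[OF Suc.prems(1)]
          Ck_on_has_derivative[OF Suc.prems(2)]])
      (use Suc in auto)
qed (simp add: continuous_on_add)

text \<open>Leibniz rule: the derivative consists of two terms of the same bilinear shape, each
  pairing one function with a derivative of the other, which is why the induction generalizes over
  both functions.\<close>

lemma Ck_on_bilinear:
  assumes "bounded_bilinear pr" "open U"
  shows "Ck_on k U f \<Longrightarrow> Ck_on k U g \<Longrightarrow> Ck_on k U (\<lambda>x. pr (f x) (g x))"
proof (induction k arbitrary: f g)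
  case 0
  then show ?case by (simp add: bounded_bilinear.continuous_on[OF assms(1)])
next
  case (Suc k)
  show ?case
    by (rule Ck_on_SucI[OF assms(2)],
        rule bounded_bilinear.FDERIV[OF assms(1) Ck_on_has_derivative[OF Suc.prems(1)]
          Ck_on_has_derivative[OF Suc.prems(2)]])
      (use Suc.IH Suc.prems Suc.prems[THEN Ck_on_Suc_D]
        in \<open>auto intro!: Ck_on_add[OF assms(2)] simp del: Ck_on.simps(1)\<close>)
qed

lemmas Ck_on_mult = Ck_on_bilinear[OF bounded_bilinear_mult]
lemmas Ck_on_scaleR = Ck_on_bilinear[OF bounded_bilinear_scaleR]
lemmas Ck_on_inner = Ck_on_bilinear[OF bounded_bilinear_inner]

lemma Ck_on_bounded_linear:
  assumes "bounded_linear L" "open U" "Ck_on k U f"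
  shows "Ck_on k U (\<lambda>x. L (f x))"
  using assms(3)
proof (induction k arbitrary: f)
  case 0
  then show ?case by (simp add: bounded_linear.continuous_on[OF assms(1)])
next
  case (Suc k)
  show ?case
    by (rule Ck_on_SucI[OF assms(2)],
        rule bounded_linear.has_derivative[OF assms(1) Ck_on_has_derivative[OF Suc.prems]])
      (use Suc in auto)
qed

lemma Ck_on_sum:
  assumes "open U" "finite I" "\<And>i. i \<in> I \<Longrightarrow> Ck_on k U (f i)"
  shows "Ck_on k U (\<lambda>x. \<Sum>i\<in>I. f i x)"
  using assms(2,3) by (induction I) (auto intro!: Ck_on_add[OF assms(1)])

lemma Ck_on_prod:
  fixes f :: "'i \<Rightarrow> 'a::euclidean_space \<Rightarrow> real"
  assumes "open U" "finite I" "\<And>i. i \<in> I \<Longrightarrow> Ck_on k U (f i)"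
  shows "Ck_on k U (\<lambda>x. \<Prod>i\<in>I. f i x)"
  using assms(2,3) by (induction I) (auto intro!: Ck_on_mult[OF assms(1)])

text \<open>The derivative of 1/f is written as a product of f' with two copies of 1/f, so the
  induction hypothesis for the same \<open>f\<close> covers it.\<close>

lemma Ck_on_inverse:
  fixes f :: "'a::euclidean_space \<Rightarrow> real"
  assumes "open U" "\<And>x. x \<in> U \<Longrightarrow> f x \<noteq> 0"
  shows "Ck_on k U f \<Longrightarrow> Ck_on k U (\<lambda>x. inverse (f x))"
proof (induction k)
  case 0
  then show ?case using assms by (auto intro: continuous_on_inverse)
next
  case (Suc k)
  have "Ck_on k U (\<lambda>x. -1 * (inverse (f x) * frechet_derivative f (at x) v * inverse (f x)))" for v
    using Suc Ck_on_Suc_D[OF Suc.prems]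
    by (intro Ck_on_mult[OF assms(1)]) (auto simp: assms(1))
  then show ?case
    by (intro Ck_on_SucI[OF assms(1)])
      (rule Deriv.has_derivative_inverse[OF assms(2) Ck_on_has_derivative[OF Suc.prems]], auto)
qed

lemma Ck_on_vec_nth: "open U \<Longrightarrow> Ck_on k U f \<Longrightarrow> Ck_on k U (\<lambda>x. f x $ i)"
  by (rule Ck_on_bounded_linear[OF bounded_linear_vec_nth])

lemma Ck_on_vec_lambda:
  fixes f :: "'a::euclidean_space \<Rightarrow> real ^ 'm::finite"
  assumes "open U" "\<And>i. Ck_on k U (\<lambda>x. f x $ i)"
  shows "Ck_on k U f"
proof -
  have "Ck_on k U (\<lambda>x. \<Sum>i\<in>UNIV. f x $ i *\<^sub>R axis i 1)"
    by (intro Ck_on_sum Ck_on_scaleR assms) (auto simp: assms)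
  then show ?thesis
    by (rule Ck_on_cong[OF assms(1)]) (simp add: vec_eq_iff axis_def if_distrib cong: if_cong)
qed

lemma Ck_on_det:
  fixes A :: "'a::euclidean_space \<Rightarrow> real ^ 'm::finite ^ 'm"
  assumes "open U" "\<And>i j. Ck_on k U (\<lambda>x. A x $ i $ j)"
  shows "Ck_on k U (\<lambda>x. det (A x))"
  unfolding det_def using assms
  by (intro Ck_on_sum Ck_on_mult Ck_on_prod) (auto simp: finite_permutations)

text \<open>Cramer's rule expresses each coordinate as a quotient of determinants. It serves twice:
  in every order for the dual frame, and in order 0 for the coefficients of the minimal
  polynomial.\<close>

lemma Ck_on_linear_solution:
  fixes A :: "'a::euclidean_space \<Rightarrow> real ^ 'm::finite ^ 'm"
  assumes "open U" "\<And>i j. Ck_on k U (\<lambda>x. A x $ i $ j)" "\<And>i. Ck_on k U (\<lambda>x. b x $ i)"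
    and "\<And>x. x \<in> U \<Longrightarrow> det (A x) \<noteq> 0" "\<And>x. x \<in> U \<Longrightarrow> A x *v y x = b x"
  shows "Ck_on k U y"
proof (rule Ck_on_vec_lambda[OF assms(1)])
  fix l
  have "Ck_on k U (\<lambda>x. det (\<chi> i j. if j = l then b x $ i else A x $ i $ j) * inverse (det (A x)))"
    using assms(2-4)
    by (intro Ck_on_mult[OF assms(1)] Ck_on_det Ck_on_inverse assms(1)) (case_tac "j = l", auto)
  then show "Ck_on k U (\<lambda>x. y x $ l)"
    using assms(4,5) by (elim Ck_on_cong[OF assms(1)]) (auto simp: cramer divide_inverse)
qed

subsection \<open>Symmetry of the second derivative\<close>

text \<open>The mean value theorem is applied twice: along \<open>a\<close> to the increment of
  \<open>f\<close> in direction \<open>b\<close>, then along \<open>b\<close> to the derivative in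
  direction \<open>a\<close>.\<close>

lemma second_difference_mean_value:
  fixes f :: "'a::euclidean_space \<Rightarrow> real"
  assumes "\<And>z. z \<in> U \<Longrightarrow> f differentiable (at z)"
    and "\<And>z. z \<in> U \<Longrightarrow> dir_deriv f a differentiable (at z)"
    and "t > 0" and sub: "\<And>s r. \<lbrakk>0 \<le> s; s \<le> t; 0 \<le> r; r \<le> t\<rbrakk> \<Longrightarrow> x + s *\<^sub>R a + r *\<^sub>R b \<in> U"
  obtains s r where "0 < s" "s < t" "0 < r" "r < t"
    "f (x + t *\<^sub>R a + t *\<^sub>R b) - f (x + t *\<^sub>R a) - f (x + t *\<^sub>R b) + f x
      = t\<^sup>2 * dir_deriv (dir_deriv f a) b (x + s *\<^sub>R a + r *\<^sub>R b)"
proof -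
  have line: "((\<lambda>s. g (y + s *\<^sub>R v)) has_derivative
      (\<lambda>d. d * frechet_derivative g (at (y + s *\<^sub>R v)) v)) (at s within S)"
    if "g differentiable (at (y + s *\<^sub>R v))" for g :: "'a \<Rightarrow> real" and y v s S
  proof -
    from that have g: "(g has_derivative frechet_derivative g (at (y + s *\<^sub>R v))) (at (y + s *\<^sub>R v))"
      by (simp add: frechet_derivative_works)
    have "((\<lambda>s. y + s *\<^sub>R v) has_derivative (\<lambda>d. d *\<^sub>R v)) (at s within S)"
      by (auto intro!: derivative_eq_intros)
    from has_derivative_compose[OF this g] show ?thesis
      using has_derivative_linear[OF g] by (simp add: linear_cmul)
  qed
  define g where "g s = f ((x + t *\<^sub>R b) + s *\<^sub>R a) - f (x + s *\<^sub>R a)" for s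
  define g' where "g' s d = d * frechet_derivative f (at ((x + t *\<^sub>R b) + s *\<^sub>R a)) a
      - d * frechet_derivative f (at (x + s *\<^sub>R a)) a" for s d
  have eq: "(x + r *\<^sub>R b) + s *\<^sub>R a = x + s *\<^sub>R a + r *\<^sub>R b" for r s
    by simp
  have "\<exists>s\<in>{0<..<t}. g t - g 0 = g' s (t - 0)"
  proof (rule mvt_simple[OF \<open>t > 0\<close>])
    fix s assume s: "0 \<le> s" "s \<le> t"
    show "(g has_derivative g' s) (at s within {0..t})"
      unfolding g_def g'_def
      using sub[OF s, of t] sub[OF s, of 0] \<open>t > 0\<close> assms(1)
      by (intro has_derivative_diff line) (auto simp: algebra_simps)
  qed
  then obtain s where s: "0 < s" "s < t" and gs: "g t - g 0 = g' s t"
    by auto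
  have "\<exists>r\<in>{0<..<t}. dir_deriv f a ((x + s *\<^sub>R a) + t *\<^sub>R b) - dir_deriv f a ((x + s *\<^sub>R a) + 0 *\<^sub>R b)
      = (t - 0) * dir_deriv (dir_deriv f a) b ((x + s *\<^sub>R a) + r *\<^sub>R b)"
    using s sub assms(2) by (intro mvt_simple[OF \<open>t > 0\<close>] line) auto
  then obtain r where r: "0 < r" "r < t"
    and "dir_deriv f a (x + s *\<^sub>R a + t *\<^sub>R b) - dir_deriv f a (x + s *\<^sub>R a)
      = t * dir_deriv (dir_deriv f a) b (x + s *\<^sub>R a + r *\<^sub>R b)"
    by auto
  then have "g' s t = t\<^sup>2 * dir_deriv (dir_deriv f a) b (x + s *\<^sub>R a + r *\<^sub>R b)"
    by (simp add: g'_def eq power2_eq_square right_diff_distrib[symmetric])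
  with gs s r show ?thesis
    by (intro that[of s r]) (auto simp: g_def algebra_simps)
qed

text \<open>The second difference over a parallelogram is symmetric in \<open>a\<close> and
  \<open>b\<close>, so both mixed derivatives take a common value at points arbitrarily near
  \<open>x\<close>. If they differed at \<open>x\<close>, continuity would keep each within half
  their distance of its value at \<open>x\<close>, which excludes a common value.\<close>

lemma dir_deriv_commute_real:
  fixes f :: "'a::euclidean_space \<Rightarrow> real"
  assumes "Ck_on 2 U f" "open U" "x \<in> U"
  shows "dir_deriv (dir_deriv f a) b x = dir_deriv (dir_deriv f b) a x"
proof (rule ccontr)
  let ?F = "dir_deriv (dir_deriv f a) b" and ?G = "dir_deriv (dir_deriv f b) a"
  assume neq: "?F x \<noteq> ?G x"
  have C2: "Ck_on (Suc (Suc 0)) U f"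
    using assms(1) by (simp add: numeral_2_eq_2)
  have "isCont (\<lambda>y. ?F y) x" "isCont (\<lambda>y. ?G y) x"
    using C2 assms(2,3) by (auto simp: continuous_on_eq_continuous_at)
  then obtain d1 d2 where d: "d1 > 0" "d2 > 0"
    and F: "\<And>y. dist y x < d1 \<Longrightarrow> dist (?F y) (?F x) < dist (?F x) (?G x) / 2"
    and G: "\<And>y. dist y x < d2 \<Longrightarrow> dist (?G y) (?G x) < dist (?F x) (?G x) / 2"
    using neq unfolding continuous_at_eps_delta dist_norm
    by (metis half_gt_zero right_minus_eq zero_less_norm_iff)
  obtain d3 where d3: "d3 > 0" "ball x d3 \<subseteq> U"
    using assms(2,3) openE by blast
  define m where "m = min d1 (min d2 d3)"
  \<comment> \<open>Keeps the whole parallelogram inside the ball of radius \<open>m\<close>; the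
    summand 1 makes the denominator positive also for a = b = 0.\<close>
  define t where "t = m / (1 + norm a + norm b)"
  have pos: "1 + norm a + norm b > 0"
    by (simp add: add_pos_nonneg)
  have m: "m > 0" using d d3 by (simp add: m_def)
  then have t: "t > 0" using pos by (simp add: t_def)
  have small: "dist (x + s *\<^sub>R a + r *\<^sub>R b) x < m" if "0 \<le> s" "s \<le> t" "0 \<le> r" "r \<le> t" for s r
  proof -
    have "norm (s *\<^sub>R a + r *\<^sub>R b) \<le> s * norm a + r * norm b"
      using that by (intro norm_triangle_le) simp
    also have "\<dots> \<le> t * norm a + t * norm b"
      using that by (intro add_mono mult_right_mono) auto
    also have "\<dots> < t * (1 + norm a + norm b)"
      using t by (simp add: algebra_simps)
    also have "\<dots> = m" using pos by (simp add: t_def)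
    finally show ?thesis by (simp add: dist_norm add.assoc)
  qed
  then have inU: "x + s *\<^sub>R a + r *\<^sub>R b \<in> U" if "0 \<le> s" "s \<le> t" "0 \<le> r" "r \<le> t" for s r
    using d3 that unfolding m_def by (auto simp: subset_eq dist_commute)
  have diff: "f differentiable (at z)" "dir_deriv f v differentiable (at z)" if "z \<in> U" for z v
    using C2 that by auto
  obtain s r where 1: "0 < s" "s < t" "0 < r" "r < t"
    "f (x + t *\<^sub>R a + t *\<^sub>R b) - f (x + t *\<^sub>R a) - f (x + t *\<^sub>R b) + f x = t\<^sup>2 * ?F (x + s *\<^sub>R a + r *\<^sub>R b)"
    using second_difference_mean_value[of U f a t x b] diff t inU by blast
  have swap: "x + s *\<^sub>R b + r *\<^sub>R a = x + r *\<^sub>R a + s *\<^sub>R b" for s r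
    by simp
  obtain s' r' where 2: "0 < s'" "s' < t" "0 < r'" "r' < t"
    "f (x + t *\<^sub>R b + t *\<^sub>R a) - f (x + t *\<^sub>R b) - f (x + t *\<^sub>R a) + f x = t\<^sup>2 * ?G (x + s' *\<^sub>R b + r' *\<^sub>R a)"
    by (rule second_difference_mean_value[of U f b t x a])
      (use diff t inU in \<open>auto simp only: swap\<close>)
  have "t\<^sup>2 * ?F (x + s *\<^sub>R a + r *\<^sub>R b) = t\<^sup>2 * ?G (x + r' *\<^sub>R a + s' *\<^sub>R b)"
    using 1(5) 2(5) unfolding swap by (simp add: algebra_simps)
  then have "?F (x + s *\<^sub>R a + r *\<^sub>R b) = ?G (x + r' *\<^sub>R a + s' *\<^sub>R b)"
    using t by simp
  moreover have "dist (?F (x + s *\<^sub>R a + r *\<^sub>R b)) (?F x) < dist (?F x) (?G x) / 2"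
    using F small[of s r] 1 by (auto simp: m_def)
  moreover have "dist (?G (x + r' *\<^sub>R a + s' *\<^sub>R b)) (?G x) < dist (?F x) (?G x) / 2"
    using G small[of r' s'] 2 by (auto simp: m_def)
  ultimately show False
    by (smt (verit, ccfv_threshold) dist_commute dist_triangle_half_r)
qed

lemma dir_deriv_bounded_linear:
  assumes "bounded_linear L" "f differentiable (at x)"
  shows "dir_deriv (\<lambda>y. L (f y)) v x = L (dir_deriv f v x)"
  using frechet_derivative_at[OF bounded_linear.has_derivative[OF assms(1)
        assms(2)[unfolded frechet_derivative_works]]] by metis

lemma dir_deriv_commute:
  fixes f :: "'a::euclidean_space \<Rightarrow> 'b::euclidean_space"
  assumes C2: "Ck_on 2 U f" and "open U" "x \<in> U"
  shows "dir_deriv (dir_deriv f a) b x = dir_deriv (dir_deriv f b) a x"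
proof (rule euclidean_eqI)
  fix i :: 'b assume "i \<in> Basis"
  have bl: "bounded_linear (\<lambda>y::'b. y \<bullet> i)"
    by (rule bounded_linear_inner_left)
  have diff: "f differentiable (at z)" "dir_deriv f v differentiable (at z)" if "z \<in> U" for z v
    using C2 that by (auto simp: numeral_2_eq_2)
  have "dir_deriv (dir_deriv (\<lambda>y. f y \<bullet> i) a) b x = dir_deriv (dir_deriv f a) b x \<bullet> i" for a b
  proof -
    have "frechet_derivative (dir_deriv (\<lambda>y. f y \<bullet> i) a) (at x)
        = frechet_derivative (\<lambda>y. dir_deriv f a y \<bullet> i) (at x)"
      by (rule frechet_derivative_cong_open[OF assms(2,3)]) (rule dir_deriv_bounded_linear[OF bl diff(1)])
    then have "dir_deriv (dir_deriv (\<lambda>y. f y \<bullet> i) a) b x = dir_deriv (\<lambda>y. dir_deriv f a y \<bullet> i) b x"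
      by simp
    also have "\<dots> = dir_deriv (dir_deriv f a) b x \<bullet> i"
      by (rule dir_deriv_bounded_linear[OF bl diff(2)[OF assms(3)]])
    finally show ?thesis .
  qed
  moreover have "Ck_on 2 U (\<lambda>y. f y \<bullet> i)"
    by (rule Ck_on_bounded_linear[OF bl assms(2,1)])
  ultimately show "dir_deriv (dir_deriv f a) b x \<bullet> i = dir_deriv (dir_deriv f b) a x \<bullet> i"
    using dir_deriv_commute_real[OF _ assms(2,3), of "\<lambda>y. f y \<bullet> i" a b] by simp
qed

lemma dir_deriv_inner:
  assumes "f differentiable (at x)" "g differentiable (at x)"
  shows "dir_deriv (\<lambda>y. f y \<bullet> g y) v x = f x \<bullet> dir_deriv g v x + dir_deriv f v x \<bullet> g x"
  using frechet_derivative_at[OF has_derivative_inner[OF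
        assms[unfolded frechet_derivative_works]]] by metis

section \<open>Spans under the two moves of the Gram-Schmidt process\<close>

lemma span_insert_scale:
  assumes "k \<noteq> 0"
  shows "span (insert (k *\<^sub>R x) B) = span (insert (x :: 'a::real_vector) B)"
proof (subst span_eq, intro conjI)
  show "insert (k *\<^sub>R x) B \<subseteq> span (insert x B)"
    by (auto intro: span_base span_scale)
  have "(1 / k) *\<^sub>R k *\<^sub>R x \<in> span (insert (k *\<^sub>R x) B)"
    by (intro span_scale span_base) simp
  with assms show "insert x B \<subseteq> span (insert (k *\<^sub>R x) B)"
    by (auto intro: span_base)
qed

lemma span_insert_diff:
  assumes "p \<in> span B"
  shows "span (insert (x - p) B) = span (insert (x :: 'a::real_vector) B)"
proof (subst span_eq, intro conjI)
  have p: "p \<in> span (insert y B)" for y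
    using assms span_mono[of B "insert y B"] by blast
  show "insert (x - p) B \<subseteq> span (insert x B)"
    using p by (auto intro: span_base span_diff)
  have "x - p + p \<in> span (insert (x - p) B)"
    by (intro span_add p span_base) simp
  then show "insert x B \<subseteq> span (insert (x - p) B)"
    by (auto intro: span_base)
qed

subsection \<open>Self-adjoint operators on a subspace\<close>

text \<open>Bilinearity is global while symmetry and positivity hold on \<open>V\<close> only: this
  is what a form pulled back through a left inverse of the differential of a parametrization
  offers.\<close>

locale form_on =
  fixes V :: "'a::euclidean_space set" and h :: "'a \<Rightarrow> 'a \<Rightarrow> real"
  assumes subspace_V: "subspace V"
    and bilinear_h: "bilinear h"
    and sym_h: "\<And>x y. x \<in> V \<Longrightarrow> y \<in> V \<Longrightarrow> h x y = h y x"
    and pos_h: "\<And>x. x \<in> V \<Longrightarrow> x \<noteq> 0 \<Longrightarrow> h x x > 0"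
begin

lemmas h_simps = bilinear_ladd[OF bilinear_h] bilinear_radd[OF bilinear_h]
  bilinear_lmul[OF bilinear_h] bilinear_rmul[OF bilinear_h]
  bilinear_lsub[OF bilinear_h] bilinear_rsub[OF bilinear_h]
  bilinear_lzero[OF bilinear_h] bilinear_rzero[OF bilinear_h]
  bilinear_lneg[OF bilinear_h] bilinear_rneg[OF bilinear_h]

lemma linear_h_left: "linear (\<lambda>x. h x y)"
  using bilinear_h by (simp add: bilinear_def)

lemma linear_h_right: "linear (h x)"
  using bilinear_h by (simp add: bilinear_def)

lemmas h_sum_left = linear_sum[OF linear_h_left]
lemmas h_sum_right = linear_sum[OF linear_h_right]

lemma h_ext:
  assumes "x \<in> V" "y \<in> V" "\<And>z. z \<in> V \<Longrightarrow> h x z = h y z"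
  shows "x = y"
proof (rule ccontr)
  assume "x \<noteq> y"
  then have "h (x - y) (x - y) > 0"
    by (intro pos_h subspace_diff[OF subspace_V] assms) auto
  moreover have "h (x - y) (x - y) = 0"
    using assms subspace_diff[OF subspace_V assms(1,2)] by (simp add: h_simps(5))
  ultimately show False by simp
qed

text \<open>In contrast to \<open>orthonormal_basis_on\<close> nothing is said about the span, so
  the notion also covers bases of eigenspaces and the stages of Gram-Schmidt.\<close>

definition orthonormal :: "'a set \<Rightarrow> bool" where
  "orthonormal B \<longleftrightarrow> B \<subseteq> V \<and> finite B \<and> (\<forall>u\<in>B. \<forall>v\<in>B. h u v = (if u = v then 1 else 0))"

lemma orthonormal_coeff:
  assumes "orthonormal B" "c \<in> B"
  shows "h (\<Sum>b\<in>B. u b *\<^sub>R b) c = u c"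
proof -
  have "h (\<Sum>b\<in>B. u b *\<^sub>R b) c = (\<Sum>b\<in>B. u b * (if b = c then 1 else 0))"
    using assms unfolding h_sum_left orthonormal_def
    by (intro sum.cong) (auto simp: h_simps)
  then show ?thesis
    using assms by (simp add: orthonormal_def if_distrib cong: if_cong)
qed

lemma orthonormal_independent:
  assumes "orthonormal B"
  shows "independent B"
proof -
  have "finite B" using assms by (simp add: orthonormal_def)
  have "u v = 0" if "(\<Sum>b\<in>B. u b *\<^sub>R b) = 0" "v \<in> B" for u v
    using orthonormal_coeff[OF assms that(2), of u] that(1) by (simp add: h_simps)
  then show ?thesis
    using \<open>finite B\<close> by (auto simp: dependent_finite)
qed

lemma orthonormal_expansion:
  assumes "orthonormal B" "x \<in> span B"
  shows "(\<Sum>b\<in>B. h x b *\<^sub>R b) = x"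
proof -
  obtain u where u: "x = (\<Sum>b\<in>B. u b *\<^sub>R b)"
    using assms by (auto simp: orthonormal_def span_finite)
  have "(\<Sum>b\<in>B. h x b *\<^sub>R b) = (\<Sum>b\<in>B. u b *\<^sub>R b)"
    unfolding u by (intro sum.cong refl) (simp add: orthonormal_coeff[OF assms(1)])
  with u show ?thesis by simp
qed

text \<open>Gram-Schmidt: \<open>p\<close> is the \<open>h\<close>-orthogonal projection of the new
  vector onto the span reached so far. Either the vector equals \<open>p\<close> and adds nothing,
  or the difference is normalized and inserted.\<close>

lemma orthonormal_span_exists:
  assumes "finite A" "A \<subseteq> V"
  shows "\<exists>B. orthonormal B \<and> span B = span A"
  using assms
proof (induction A)
  case empty
  have "orthonormal {}" by (simp add: orthonormal_def)
  then show ?case by blast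
next
  case (insert a A)
  then obtain B where B: "orthonormal B" "span B = span A" by auto
  then have BV: "B \<subseteq> V" and finB: "finite B" by (auto simp: orthonormal_def)
  define p where "p = (\<Sum>b\<in>B. h a b *\<^sub>R b)"
  have pB: "p \<in> span B"
    unfolding p_def by (auto intro!: span_sum span_scale intro: span_base)
  have spV: "span B \<subseteq> V"
    using BV subspace_V by (simp add: span_minimal)
  have aV: "a \<in> V" using insert by simp
  show ?case
  proof (cases "a = p")
    case True
    then have "span (insert a A) = span A"
      using pB B by (simp add: span_redundant)
    with B show ?thesis by auto
  next
    case False
    define d where "d = a - p"
    define e where "e = (1 / sqrt (h d d)) *\<^sub>R d"
    have dV: "d \<in> V"
      using aV pB spV by (auto simp: d_def intro: subspace_diff[OF subspace_V])
    have dd: "h d d > 0" using dV False by (intro pos_h) (auto simp: d_def)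
    have dB: "h d b = 0" if "b \<in> B" for b
      unfolding d_def h_simps p_def using orthonormal_coeff[OF B(1) that] by simp
    have eV: "e \<in> V" unfolding e_def by (intro subspace_scale[OF subspace_V] dV)
    have ee: "h e e = 1" using dd by (simp add: e_def h_simps)
    have eB: "h e b = 0" "h b e = 0" if "b \<in> B" for b
      using dB[OF that] that BV sym_h[OF eV, of b] by (auto simp: e_def h_simps)
    have "orthonormal (insert e B)"
      using B(1) eV ee eB unfolding orthonormal_def by auto
    moreover have "span (insert e B) = span (insert a A)"
    proof -
      have "span (insert e B) = span (insert d B)"
        using dd by (simp add: e_def span_insert_scale)
      also have "\<dots> = span (insert a B)"
        using pB unfolding d_def by (rule span_insert_diff)
      also have "\<dots> = span (insert a A)"
        by (metis B(2) span_insert)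
      finally show ?thesis .
    qed
    ultimately show ?thesis by blast
  qed
qed

lemma orthonormal_basis_exists:
  assumes "subspace W" "W \<subseteq> V"
  shows "\<exists>B. orthonormal B \<and> span B = W"
proof -
  obtain A where A: "A \<subseteq> W" "independent A" "W \<subseteq> span A"
    using basis_exists[of W] by metis
  then have "span A = W"
    using assms(1) by (simp add: span_minimal subset_antisym)
  with orthonormal_span_exists[of A] A assms(2) show ?thesis
    by (auto dest: independent_imp_finite)
qed

lemma orthonormal_basis_on_iff: "orthonormal_basis_on V h B \<longleftrightarrow> orthonormal B \<and> span B = V"
  by (auto simp: orthonormal_basis_on_def orthonormal_def)

text \<open>Basis independence of the trace, in a form that fits both the basis picked by
  \<open>trace_on\<close> and the coordinate frame of a parametrization: any vectors
  \<open>p\<close> with functionals \<open>c\<close> that reproduce \<open>V\<close> compute it.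
  Expand \<open>T (p i)\<close> in \<open>B\<close> and exchange the sums.\<close>

lemma trace_dual_system:
  assumes B: "orthonormal B" "span B = V"
    and T: "linear T" "\<And>x. x \<in> V \<Longrightarrow> T x \<in> V"
    and c: "\<And>i. i \<in> I \<Longrightarrow> linear (c i)" "\<And>x. x \<in> V \<Longrightarrow> (\<Sum>i\<in>I. c i x *\<^sub>R p i) = x"
    and p: "\<And>i. i \<in> I \<Longrightarrow> p i \<in> V"
  shows "(\<Sum>i\<in>I. c i (T (p i))) = (\<Sum>e\<in>B. h (T e) e)"
proof -
  have BV: "B \<subseteq> V" using B by (simp add: orthonormal_def)
  have "(\<Sum>i\<in>I. c i (T (p i))) = (\<Sum>i\<in>I. \<Sum>e\<in>B. h (T (p i)) e * c i e)"
  proof (rule sum.cong[OF refl])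
    fix i assume i: "i \<in> I"
    have "c i (T (p i)) = c i (\<Sum>e\<in>B. h (T (p i)) e *\<^sub>R e)"
      using orthonormal_expansion[OF B(1)] B(2) T(2) p[OF i] by simp
    then show "c i (T (p i)) = (\<Sum>e\<in>B. h (T (p i)) e * c i e)"
      using c(1)[OF i] by (simp add: linear_sum linear_scale)
  qed
  also have "\<dots> = (\<Sum>e\<in>B. \<Sum>i\<in>I. h (T (p i)) e * c i e)"
    by (rule sum.swap)
  \<comment> \<open>The inner sum over \<open>i\<close> reassembles the basis vector
    \<open>e\<close>.\<close>
  also have "\<dots> = (\<Sum>e\<in>B. h (T (\<Sum>i\<in>I. c i e *\<^sub>R p i)) e)"
    by (simp add: linear_sum[OF T(1)] linear_scale[OF T(1)] h_sum_left h_simps mult.commute)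
  also have "\<dots> = (\<Sum>e\<in>B. h (T e) e)"
    using c(2) BV by (intro sum.cong refl) (auto simp: subset_eq)
  finally show ?thesis .
qed

lemma trace_on_orthonormal:
  assumes B: "orthonormal B" "span B = V"
    and T: "linear T" "\<And>x. x \<in> V \<Longrightarrow> T x \<in> V"
  shows "trace_on V T = (\<Sum>e\<in>B. h (T e) e)"
proof -
  define C where "C = (SOME C. C \<subseteq> V \<and> independent C \<and> span C = V)"
  have "\<exists>C. C \<subseteq> V \<and> independent C \<and> span C = V"
    using B orthonormal_independent by (auto simp: orthonormal_def)
  from someI_ex[OF this] have C: "C \<subseteq> V" "independent C" "span C = V"
    by (auto simp: C_def)
  have finC: "finite C" using C(2) by (rule independent_imp_finite)
  obtain c where c: "\<And>b. b \<in> C \<Longrightarrow> linear (c b)" "\<And>x b. x \<in> V \<Longrightarrow> b \<in> C \<Longrightarrow> c b x = representation C x b"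
  proof -
    \<comment> \<open>\<open>representation C\<close> is 0 off the span of \<open>C\<close>, hence
      in general not linear on the whole space; each coordinate functional is extended linearly from
      the basis.\<close>
    have "\<exists>c. linear c \<and> (\<forall>x\<in>V. c x = representation C x b)" for b
    proof -
      obtain f where f: "linear f" "\<forall>x\<in>C. f x = (if x = b then 1 else 0 :: real)"
        using linear_independent_extend[OF C(2), of "\<lambda>x. if x = b then 1 else 0"] by blast
      have "f x = representation C x b" if "x \<in> V" for x
      proof -
        have "f x = f (\<Sum>d\<in>C. representation C x d *\<^sub>R d)"
          using sum_representation_eq[OF C(2) _ finC order_refl, of x] C(3) that by simp
        also have "\<dots> = (\<Sum>d\<in>C. representation C x d * (if d = b then 1 else 0))"
          using f(2) by (simp add: linear_sum[OF f(1)] linear_scale[OF f(1)])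
        also have "\<dots> = representation C x b"
          using finC representation_ne_zero[of C x b] by (cases "b \<in> C") (auto simp: if_distrib cong: if_cong)
        finally show ?thesis .
      qed
      with f(1) show ?thesis by blast
    qed
    then show ?thesis using that by metis
  qed
  have "(\<Sum>b\<in>C. c b (T b)) = (\<Sum>e\<in>B. h (T e) e)"
  proof (rule trace_dual_system[OF B T c(1)])
    fix x assume "x \<in> V"
    then show "(\<Sum>b\<in>C. c b x *\<^sub>R b) = x"
      using sum_representation_eq[OF C(2) _ finC order_refl, of x] C(3) by (simp add: c(2))
  qed (use C in auto)
  moreover have "trace_on V T = (\<Sum>b\<in>C. representation C (T b) b)"
    by (simp add: trace_on_def Let_def C_def)
  moreover have "\<dots> = (\<Sum>b\<in>C. c b (T b))"
    using C(1) T(2) by (intro sum.cong refl) (auto simp: c(2) subset_eq)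
  ultimately show ?thesis by simp
qed

end

section \<open>Eigenvectors of self-adjoint operators\<close>

locale self_adjoint_on = form_on +
  fixes T :: "'a \<Rightarrow> 'a"
  assumes linear_T: "linear T"
    and T_in: "\<And>x. x \<in> V \<Longrightarrow> T x \<in> V"
    and adj: "\<And>x y. x \<in> V \<Longrightarrow> y \<in> V \<Longrightarrow> h (T x) y = h x (T y)"
begin

lemmas T_simps = linear_add[OF linear_T] linear_diff[OF linear_T] linear_scale[OF linear_T]
  linear_0[OF linear_T] linear_neg[OF linear_T]

text \<open>A maximum point \<open>v\<close> of the Rayleigh quotient is an eigenvector: for the
  maximal value \<open>m\<close>, the form \<open>q\<close> is positive semidefinite on
  \<open>W\<close> and vanishes at \<open>(v, v)\<close>, so \<open>q v\<close> vanishes on all of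
  \<open>W\<close>, in particular on the residual m v - T v.\<close>

lemma invariant_subspace_eigenvector:
  assumes W: "subspace W" "W \<subseteq> V" "\<And>x. x \<in> W \<Longrightarrow> T x \<in> W" "\<exists>x\<in>W. x \<noteq> 0"
  shows "\<exists>v\<in>W. v \<noteq> 0 \<and> (\<exists>l. T v = l *\<^sub>R v)"
proof -
  \<comment> \<open>The sphere is Euclidean, which gives compactness at once; the quotient
    \<open>f\<close> is invariant under scaling, so its maximum on \<open>K\<close> bounds it on all
    non-zero vectors of \<open>W\<close>.\<close>
  define K where "K = W \<inter> sphere 0 1"
  define f where "f v = h v (T v) / h v v" for v
  have cont: "continuous_on K (\<lambda>v. h v (g v))" if "linear g" for g
    using bilinear_conv_bounded_bilinear that bilinear_h
    by (intro bounded_bilinear.continuous_on[of h] linear_continuous_on)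
      (auto simp: linear_conv_bounded_linear)
  have hpos: "h v v > 0" if "v \<in> W" "v \<noteq> 0" for v
    using pos_h that W(2) by blast
  have "compact K"
    unfolding K_def by (intro closed_Int_compact closed_subspace W) auto
  moreover obtain x where "x \<in> W" "x \<noteq> 0" using W(4) by blast
  then have "(1 / norm x) *\<^sub>R x \<in> K"
    by (simp add: K_def subspace_scale[OF W(1)])
  then have "K \<noteq> {}" by blast
  moreover have "continuous_on K f"
    unfolding f_def using hpos cont[OF linear_T] cont[OF linear_ident]
    by (intro continuous_on_divide) (force simp: K_def)+
  ultimately obtain v where v: "v \<in> K" and max: "\<And>w. w \<in> K \<Longrightarrow> f w \<le> f v"
    using continuous_attains_sup by metis
  define m where "m = f v"
  have vW: "v \<in> W" "v \<noteq> 0" using v by (auto simp: K_def)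
  define q where "q w z = m * h w z - h w (T z)" for w z
  have q_nonneg: "q w w \<ge> 0" if "w \<in> W" for w
  proof (cases "w = 0")
    case False
    have "f w = f ((1 / norm w) *\<^sub>R w)"
      using False by (simp add: f_def h_simps T_simps)
    also have "\<dots> \<le> m"
      unfolding m_def using False that by (intro max) (simp add: K_def subspace_scale[OF W(1)])
    finally show ?thesis
      using hpos[OF that False] by (simp add: f_def q_def field_simps)
  qed (simp add: q_def h_simps)
  have qvv: "q v v = 0"
    using hpos[OF vW] by (simp add: q_def m_def f_def)
  have qvw: "q v w = 0" if w: "w \<in> W" for w
  proof (rule ccontr)
    assume ne: "q v w \<noteq> 0"
    have sym: "q w v = q v w"
    proof -
      have "w \<in> V" "v \<in> V" using w vW(1) W(2) by auto
      then show ?thesis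
        using adj[of w v] sym_h[of w v] sym_h[of "T w" v] T_in by (simp add: q_def)
    qed
    have expand: "q (v + t *\<^sub>R w) (v + t *\<^sub>R w) = 2 * t * q v w + t\<^sup>2 * q w w" for t
    proof -
      have "q (v + t *\<^sub>R w) (v + t *\<^sub>R w) = q v v + t * q v w + t * q w v + t\<^sup>2 * q w w"
        by (simp add: q_def h_simps T_simps algebra_simps power2_eq_square)
      then show ?thesis using qvv sym by simp
    qed
    \<comment> \<open>The minimum of the quadratic polynomial in t would be at - q v w / q w w; the
      added 1 keeps the denominator positive when \<open>q w w\<close> is 0, and the value is still
      negative.\<close>
    define t where "t = - q v w / (q w w + 1)"
    have qw: "q w w \<ge> 0" using q_nonneg w by blast
    have "0 \<le> 2 * t * q v w + t\<^sup>2 * q w w"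
      using q_nonneg[of "v + t *\<^sub>R w"] expand vW w W(1) by (simp add: subspace_add subspace_scale)
    also have "\<dots> = - (q v w)\<^sup>2 * (q w w + 2) / (q w w + 1)\<^sup>2"
      using qw unfolding t_def by (simp add: divide_simps) (simp add: algebra_simps power2_eq_square)
    also have "\<dots> < 0"
      using ne qw by (simp add: divide_simps mult_pos_pos)
    finally show False by simp
  qed
  \<comment> \<open>For this residual, which lies in \<open>W\<close> by invariance,
    \<open>h w w\<close> equals \<open>q v w\<close>, hence 0.\<close>
  define w where "w = m *\<^sub>R v - T v"
  have wW: "w \<in> W"
    unfolding w_def using vW W by (simp add: subspace_diff subspace_scale)
  have "h w w = q v w"
  proof -
    have "h w w = h (m *\<^sub>R v - T v) w" by (simp only: w_def)
    also have "\<dots> = m * h v w - h (T v) w" by (simp add: h_simps)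
    finally show ?thesis using vW(1) wW W(2) adj[of v w] by (auto simp: q_def)
  qed
  then have "w = 0"
    using qvw[OF wW] hpos[OF wW] by fastforce
  then have "T v = m *\<^sub>R v" by (simp add: w_def)
  with vW show ?thesis by blast
qed

end

section \<open>Operators with exactly three eigenvalues\<close>

locale three_eigenvalues = self_adjoint_on +
  fixes a b c :: real
  assumes distinct: "a \<noteq> b" "a \<noteq> c" "b \<noteq> c"
    and spectrum: "{l. \<exists>v\<in>V. v \<noteq> 0 \<and> T v = l *\<^sub>R v} = {a, b, c}"
begin

text \<open>\<open>p(T)\<close> vanishes for \<open>p = (t - a)(t - b)(t - c)\<close>: its range is invariant, and an eigenvector in it
  would be orthogonal to itself.\<close>

lemma cubic:
  assumes "x \<in> V"
  shows "T (T (T x)) = (a + b + c) *\<^sub>R T (T x) - (a * b + a * c + b * c) *\<^sub>R T x + (a * b * c) *\<^sub>R x"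
proof -
  define p where "p x = T (T (T x)) - (a + b + c) *\<^sub>R T (T x) + (a * b + a * c + b * c) *\<^sub>R T x
    - (a * b * c) *\<^sub>R x" for x
  have lin: "linear p"
    unfolding p_def by (intro linearI) (simp_all add: T_simps algebra_simps)
  have pT: "p (T x) = T (p x)" for x
    by (simp add: p_def T_simps)
  have pV: "p x \<in> V" if "x \<in> V" for x
    unfolding p_def using that T_in subspace_V by (intro subspace_diff subspace_add subspace_scale) auto
  have padj: "h (p x) y = h x (p y)" if "x \<in> V" "y \<in> V" for x y
    using that T_in adj by (simp add: p_def h_simps)
  have "p x = 0" if "x \<in> V" for x
  proof (rule ccontr)
    assume "p x \<noteq> 0"
    with that have "\<exists>y\<in>p ` V. y \<noteq> 0" by blast
    moreover have "p ` V \<subseteq> V" using pV by blast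
    moreover have "T y \<in> p ` V" if "y \<in> p ` V" for y
    proof -
      from that obtain z where "z \<in> V" "y = p z" by blast
      then have "T y = p (T z)" "T z \<in> V" using pT T_in by auto
      then show ?thesis by blast
    qed
    ultimately obtain v l where v: "v \<in> p ` V" "v \<noteq> 0" "T v = l *\<^sub>R v"
      using invariant_subspace_eigenvector[OF linear_subspace_image[OF lin subspace_V]] by blast
    obtain y where y: "y \<in> V" "v = p y" using v(1) by blast
    then have vV: "v \<in> V" using pV by simp
    have "l \<in> {a, b, c}" using v vV spectrum by blast
    then have "p v = 0"
      by (auto simp: p_def v(3) T_simps algebra_simps)
    then have "h v v = 0"
      using padj[OF y(1) vV] y(2) by (simp add: h_simps)
    with pos_h[OF vV v(2)] show False by simp
  qed
  from this[OF assms] show ?thesis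
    by (simp add: p_def algebra_simps)
qed

abbreviation eigenspace :: "real \<Rightarrow> 'a set" where
  "eigenspace l \<equiv> {v \<in> V. T v = l *\<^sub>R v}"

lemma subspace_eigenspace: "subspace (eigenspace l)"
  using subspace_V by (auto simp: subspace_def T_simps algebra_simps)

lemma eigenspace_orthogonal:
  assumes "x \<in> eigenspace l" "y \<in> eigenspace m" "l \<noteq> m"
  shows "h x y = 0"
proof -
  have "l * h x y = m * h x y"
    using adj[of x y] assms by (simp add: h_simps)
  with assms(3) show ?thesis by simp
qed

text \<open>Lagrange interpolation at the three eigenvalues: the interpolation polynomials of degree
  2 add up to 1, and by the cubic relation each of them, applied to \<open>T\<close>, maps
  \<open>V\<close> into one eigenspace.\<close>

lemma eigenspace_decomposition:
  assumes "x \<in> V"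
  obtains u v w where "u \<in> eigenspace a" "v \<in> eigenspace b" "w \<in> eigenspace c" "x = u + v + w"
proof -
  \<comment> \<open>This is k (T - p)(T - q) x. The remaining root \<open>r\<close> enters below
    only through the symmetric functions of p, q, r, so one argument serves all three
    eigenspaces.\<close>
  define L where "L k p q = k *\<^sub>R (T (T x) - (p + q) *\<^sub>R T x + (p * q) *\<^sub>R x)" for k p q
  have L: "L k p q \<in> eigenspace r" if "p + q + r = a + b + c"
    "p * q + p * r + q * r = a * b + a * c + b * c" "p * q * r = a * b * c" for k p q r
  proof -
    have "L k p q \<in> V"
      unfolding L_def using assms T_in subspace_V by (intro subspace_diff subspace_add subspace_scale) auto
    moreover have "T (T (T x)) = (p + q + r) *\<^sub>R T (T x) - (p * q + p * r + q * r) *\<^sub>R T x + (p * q * r) *\<^sub>R x"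
      using cubic[OF assms] that by metis
    then have "T (T (T x) - (p + q) *\<^sub>R T x + (p * q) *\<^sub>R x)
        = r *\<^sub>R (T (T x) - (p + q) *\<^sub>R T x + (p * q) *\<^sub>R x)"
      unfolding T_simps by (simp add: algebra_simps)
    then have "T (L k p q) = r *\<^sub>R L k p q"
      by (simp add: L_def linear_scale[OF linear_T])
    ultimately show ?thesis by simp
  qed
  define D where "D = (a - b) * (a - c) * (b - c)"
  \<comment> \<open>The Lagrange weights over a common denominator; for instance \<open>k1\<close>
    is 1 / ((a - b)(a - c)). The next identities compare the coefficients of T^2, T and 1 in the sum
    of the interpolation polynomials.\<close>
  define k1 k2 k3 where "k1 = (b - c) / D" and "k2 = (c - a) / D" and "k3 = (a - b) / D"
  have D: "D \<noteq> 0" using distinct by (simp add: D_def)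
  have "k1 + k2 + k3 = 0" "k1 * (b + c) + k2 * (a + c) + k3 * (a + b) = 0"
    by (simp_all add: k1_def k2_def k3_def add_divide_distrib[symmetric]) (simp add: algebra_simps)
  moreover have "k1 * (b * c) + k2 * (a * c) + k3 * (a * b) = 1"
  proof -
    have "k1 * (b * c) + k2 * (a * c) + k3 * (a * b)
        = ((b - c) * (b * c) + (c - a) * (a * c) + (a - b) * (a * b)) / D"
      by (simp add: k1_def k2_def k3_def add_divide_distrib)
    also have "(b - c) * (b * c) + (c - a) * (a * c) + (a - b) * (a * b) = D"
      by (simp add: D_def algebra_simps)
    finally show ?thesis using D by simp
  qed
  moreover have "L k1 b c + L k2 a c + L k3 a b = (k1 + k2 + k3) *\<^sub>R T (T x)
      - (k1 * (b + c) + k2 * (a + c) + k3 * (a + b)) *\<^sub>R T x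
      + (k1 * (b * c) + k2 * (a * c) + k3 * (a * b)) *\<^sub>R x"
    by (simp add: L_def algebra_simps)
  ultimately have "x = L k1 b c + L k2 a c + L k3 a b" by simp
  moreover have "L k1 b c \<in> eigenspace a" "L k2 a c \<in> eigenspace b" "L k3 a b \<in> eigenspace c"
    by (intro L; simp add: algebra_simps)+
  ultimately show ?thesis using that by blast
qed

text \<open>Orthonormal bases of the three eigenspaces are mutually orthogonal and together span
  \<open>V\<close>, so they form one orthonormal basis on which the trace is read off.\<close>

lemma trace_eigenvalues:
  "trace_on V T = a * dim (eigenspace a) + b * dim (eigenspace b) + c * dim (eigenspace c)"
proof -
  have "\<exists>B. orthonormal B \<and> span B = eigenspace l" for l
    using orthonormal_basis_exists[OF subspace_eigenspace] by blast
  then obtain B where B: "\<And>l. orthonormal (B l)" "\<And>l. span (B l) = eigenspace l"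
    by metis
  have BE: "B l \<subseteq> eigenspace l" for l
    using span_superset[of "B l"] B(2) by simp
  have fin: "finite (B l)" for l using B(1) by (simp add: orthonormal_def)
  have ortho: "h x y = 0" if "x \<in> B l" "y \<in> B m" "l \<noteq> m" for x y l m
    using eigenspace_orthogonal that BE by blast
  \<comment> \<open>A common vector would have \<open>h\<close>-square both 1 and 0.\<close>
  have disj: "B l \<inter> B m = {}" if "l \<noteq> m" for l m
    using ortho[OF _ _ that] B(1)[of l] unfolding orthonormal_def by fastforce
  have sum_eig: "(\<Sum>e\<in>B l. h (T e) e) = l * dim (eigenspace l)" for l
  proof -
    have "(\<Sum>e\<in>B l. h (T e) e) = (\<Sum>e\<in>B l. l)"
      using BE[of l] B(1)[of l] by (intro sum.cong refl) (auto simp: orthonormal_def h_simps)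
    also have "\<dots> = l * card (B l)" by simp
    also have "card (B l) = dim (eigenspace l)"
      using dim_span_eq_card_independent[OF orthonormal_independent[OF B(1)]] B(2) by metis
    finally show ?thesis .
  qed
  let ?B = "B a \<union> B b \<union> B c"
  have "orthonormal ?B"
    unfolding orthonormal_def
  proof (intro conjI ballI)
    fix u v assume "u \<in> ?B" "v \<in> ?B"
    then obtain l m where lm: "u \<in> B l" "v \<in> B m" by blast
    show "h u v = (if u = v then 1 else 0)"
    proof (cases "l = m")
      case True
      with lm B(1)[of l] show ?thesis by (simp add: orthonormal_def)
    next
      case False
      with lm disj ortho show ?thesis by fastforce
    qed
  qed (use BE fin in auto)
  moreover have "span ?B = V"
  proof
    show "span ?B \<subseteq> V" using BE subspace_V by (intro span_minimal) auto
    show "V \<subseteq> span ?B"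
    proof
      fix x assume "x \<in> V"
      then obtain u v w where "u \<in> eigenspace a" "v \<in> eigenspace b" "w \<in> eigenspace c" "x = u + v + w"
        by (rule eigenspace_decomposition)
      moreover have "eigenspace l \<subseteq> span ?B" if "l \<in> {a, b, c}" for l
        unfolding B(2)[symmetric] using that by (intro span_mono) auto
      ultimately show "x \<in> span ?B"
        by (auto intro!: span_add)
    qed
  qed
  ultimately have "trace_on V T = (\<Sum>e\<in>?B. h (T e) e)"
    using linear_T T_in by (rule trace_on_orthonormal)
  also have "\<dots> = (\<Sum>e\<in>B a. h (T e) e) + (\<Sum>e\<in>B b. h (T e) e) + (\<Sum>e\<in>B c. h (T e) e)"
    using fin disj distinct by (subst sum.union_disjoint; auto)+
  finally show ?thesis by (simp add: sum_eig)
qed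

end

section \<open>Ricci tensor and tensor square in terms of the operator\<close>

context self_adjoint_on
begin

text \<open>The basis chosen in \<open>trace_on\<close> depends on \<open>V\<close> alone, so only
  the values of the operator on \<open>V\<close> matter. This lets the linear \<open>T\<close> stand
  in for the shape operator.\<close>

lemma trace_on_cong:
  assumes "\<And>x. x \<in> V \<Longrightarrow> N x = T x"
  shows "trace_on V N = trace_on V T"
proof -
  define C where "C = (SOME C. C \<subseteq> V \<and> independent C \<and> span C = V)"
  have "\<exists>C. C \<subseteq> V \<and> independent C \<and> span C = V"
    using basis_exists[of V] subspace_V by (metis span_minimal subset_antisym)
  from someI_ex[OF this] have "C \<subseteq> V" by (simp add: C_def)
  then have "(\<Sum>b\<in>C. representation C (N b) b) = (\<Sum>b\<in>C. representation C (T b) b)"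
    using assms by (intro sum.cong refl) (auto simp: subset_eq)
  then show ?thesis by (simp add: trace_on_def Let_def C_def)
qed

definition ricci_endo :: "'a \<Rightarrow> 'a" where
  "ricci_endo x = trace_on V T *\<^sub>R T x - T (T x)"

lemma ricci_endo_in: "x \<in> V \<Longrightarrow> ricci_endo x \<in> V"
  unfolding ricci_endo_def using T_in subspace_V by (intro subspace_diff subspace_scale) auto

text \<open>The tensors \<open>g\<close> and \<open>F\<close> are only known on \<open>V\<close>, outside of which they may be junk.\<close>

lemma ricci_on_kulkarni_nomizu:
  assumes g: "\<And>x y. x \<in> V \<Longrightarrow> y \<in> V \<Longrightarrow> g x y = h x y"
    and F: "\<And>x y. x \<in> V \<Longrightarrow> y \<in> V \<Longrightarrow> F x y = h x (T y)"
    and xy: "x \<in> V" "y \<in> V"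
  shows "ricci_on V g (\<lambda>X1 X2 X3 X4. 1 / 2 * kulkarni_nomizu F F X1 X2 X3 X4) x y = h (ricci_endo x) y"
proof -
  define B where "B = (SOME B. orthonormal_basis_on V g B)"
  have "orthonormal_basis_on V g C \<longleftrightarrow> orthonormal_basis_on V h C" for C
    using g by (auto simp: orthonormal_basis_on_def subset_eq)
  then have "\<exists>C. orthonormal_basis_on V g C"
    using orthonormal_basis_exists[OF subspace_V order_refl] orthonormal_basis_on_iff by blast
  from someI_ex[OF this] have "orthonormal_basis_on V g B" by (simp add: B_def)
  then have B: "orthonormal B" "span B = V"
    using g by (auto simp: orthonormal_basis_on_def orthonormal_def subset_eq)
  have BV: "e \<in> V" if "e \<in> B" for e using B that by (auto simp: orthonormal_def)
  \<comment> \<open>The four terms pair up to F(e,e) F(x,y) - F(e,y) F(x,e). The second product is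
    put inside \<open>h\<close>, so that summing over \<open>e\<close> gives the orthonormal
    expansion of \<open>T y\<close>.\<close>
  have "1 / 2 * kulkarni_nomizu F F e x y e = h (T e) e * h (T x) y - h (T x) (h (T y) e *\<^sub>R e)"
    if "e \<in> B" for e
    using BV[OF that] xy T_in adj[of e e] adj[of x y] adj[of x e] sym_h[of e "T y"]
    by (simp add: kulkarni_nomizu_def F h_simps)
  then have "ricci_on V g (\<lambda>X1 X2 X3 X4. 1 / 2 * kulkarni_nomizu F F X1 X2 X3 X4) x y
      = (\<Sum>e\<in>B. h (T e) e * h (T x) y - h (T x) (h (T y) e *\<^sub>R e))"
    unfolding ricci_on_def B_def[symmetric] by (intro sum.cong refl)
  also have "\<dots> = (\<Sum>e\<in>B. h (T e) e) * h (T x) y - h (T x) (\<Sum>e\<in>B. h (T y) e *\<^sub>R e)"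
    by (simp add: sum_subtractf sum_distrib_right h_sum_right)
  also have "(\<Sum>e\<in>B. h (T e) e) = trace_on V T"
    using trace_on_orthonormal[OF B linear_T T_in] by simp
  also have "(\<Sum>e\<in>B. h (T y) e *\<^sub>R e) = T y"
    using orthonormal_expansion[OF B(1)] B(2) T_in xy by simp
  also have "h (T x) (T y) = h (T (T x)) y"
    using adj[of "T x" y] T_in xy by simp
  finally show ?thesis by (simp add: ricci_endo_def h_simps)
qed

text \<open>Definiteness of \<open>h\<close> on \<open>V\<close> makes \<open>Q x\<close> the only
  vector of \<open>V\<close> representing \<open>E x\<close>, which resolves the description in
  \<open>assoc_endo_on\<close>.\<close>

lemma tensor_square_on_endo:
  assumes g: "\<And>x y. x \<in> V \<Longrightarrow> y \<in> V \<Longrightarrow> g x y = h x y"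
    and E: "\<And>x y. x \<in> V \<Longrightarrow> y \<in> V \<Longrightarrow> E x y = h (Q x) y"
    and Q: "\<And>x. x \<in> V \<Longrightarrow> Q x \<in> V"
    and xy: "x \<in> V" "y \<in> V"
  shows "tensor_square_on V g E x y = h (Q (Q x)) y"
proof -
  have "assoc_endo_on V g E x = Q x"
    unfolding assoc_endo_on_def
  proof (rule the_equality)
    show "Q x \<in> V \<and> (\<forall>Y\<in>V. g (Q x) Y = E x Y)"
      using g E Q xy by simp
    fix Z assume "Z \<in> V \<and> (\<forall>Y\<in>V. g Z Y = E x Y)"
    then show "Z = Q x"
      using g E Q xy by (intro h_ext) auto
  qed
  then show ?thesis
    using E Q xy by (simp add: tensor_square_on_def)
qed

end

text \<open>The origin of \<open>A\<close> and \<mu>: modulo the cubic relation, (\<tau> T - T^2)^2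
  has T^2-coefficient (\<alpha> - \<tau>)^2 + \<beta> and constant term \<gamma> (\<alpha> - 2
  \<tau>). The two correction terms cancel exactly these, and \<mu> is the coefficient of
  \<open>T\<close> that remains. In the proof, \<open>p\<close> turns the cubic relation into a
  scalar recurrence of order 3.\<close>

lemma (in three_eigenvalues) ricci_endo_square:
  fixes \<tau> \<alpha> \<beta> \<gamma> :: real
  assumes xy: "x \<in> V" "y \<in> V"
    and \<tau>: "\<tau> = trace_on V T"
    and abc: "\<alpha> = a + b + c" "\<beta> = - (a * b + a * c + b * c)" "\<gamma> = a * b * c"
  shows "h (ricci_endo (ricci_endo x)) y + ((\<alpha> - \<tau>)\<^sup>2 + \<beta>) * h (ricci_endo x) y
      - \<gamma> * (\<alpha> - 2 * \<tau>) * h x y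
    = (\<gamma> + (\<alpha> - \<tau>) * (\<beta> + \<tau> * (\<alpha> - \<tau>))) * h (T x) y"
proof -
  define p where "p k = h ((T ^^ k) x) y" for k
  have T_pow: "(T ^^ k) x \<in> V" for k
    by (induction k) (auto simp: xy T_in)
  have rec: "p (k + 3) = \<alpha> * p (k + 2) + \<beta> * p (k + 1) + \<gamma> * p k" for k
  proof -
    have "(T ^^ (k + 3)) x = T (T (T ((T ^^ k) x)))" "(T ^^ (k + 2)) x = T (T ((T ^^ k) x))"
      by (simp_all add: eval_nat_numeral)
    then have "p (k + 3) = h ((a + b + c) *\<^sub>R T (T ((T ^^ k) x))
        - (a * b + a * c + b * c) *\<^sub>R T ((T ^^ k) x) + (a * b * c) *\<^sub>R (T ^^ k) x) y"
      unfolding p_def by (simp only: cubic[OF T_pow[of k]])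
    moreover have "(T ^^ (k + 2)) x = T (T ((T ^^ k) x))" by (simp add: eval_nat_numeral)
    ultimately show ?thesis
      by (simp add: p_def h_simps abc) (simp add: algebra_simps)
  qed
  have p3: "p 3 = \<alpha> * p 2 + \<beta> * p 1 + \<gamma> * p 0"
    using rec[of 0] by (simp add: eval_nat_numeral)
  have p4: "p 4 = \<alpha> * (\<alpha> * p 2 + \<beta> * p 1 + \<gamma> * p 0) + \<beta> * p 2 + \<gamma> * p 1"
    using rec[of 1] unfolding p3[symmetric] by (simp add: eval_nat_numeral)
  have r: "h x y = p 0" "h (T x) y = p 1" "h (T (T x)) y = p 2" "h (T (T (T x))) y = p 3"
    "h (T (T (T (T x)))) y = p 4"
    by (simp_all add: p_def eval_nat_numeral)
  have Q: "h (ricci_endo x) y = \<tau> * p 1 - p 2"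
    by (simp add: ricci_endo_def h_simps \<tau> r)
  have QQ: "h (ricci_endo (ricci_endo x)) y = \<tau>\<^sup>2 * p 2 - 2 * \<tau> * p 3 + p 4"
    by (simp add: ricci_endo_def h_simps T_simps \<tau>[symmetric] r power2_eq_square algebra_simps)
  show ?thesis
    unfolding Q QQ r p3 p4 by (simp add: power2_eq_square algebra_simps)
qed

text \<open>Take the sum of one eigenvector for each eigenvalue. A relation between x, T x and T^2 x
  makes the polynomial p + q t + r t^2 vanish at three distinct points.\<close>

lemma (in three_eigenvalues) cyclic_vector:
  "\<exists>x\<in>V. \<forall>p q r. p *\<^sub>R x + q *\<^sub>R T x + r *\<^sub>R T (T x) = 0 \<longrightarrow> p = 0 \<and> q = 0 \<and> r = 0"
proof -
  have "\<exists>v\<in>eigenspace l. v \<noteq> 0" if "l \<in> {a, b, c}" for l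
    using that spectrum by blast
  then obtain e where e: "\<And>l. l \<in> {a, b, c} \<Longrightarrow> e l \<in> eigenspace l" "\<And>l. l \<in> {a, b, c} \<Longrightarrow> e l \<noteq> 0"
    by metis
  define x where "x = e a + e b + e c"
  have xV: "x \<in> V"
    unfolding x_def using e(1) subspace_V by (intro subspace_add) auto
  have "p = 0 \<and> q = 0 \<and> r = 0" if eq: "p *\<^sub>R x + q *\<^sub>R T x + r *\<^sub>R T (T x) = 0" for p q r
  proof -
    have root: "p + q * l + r * l\<^sup>2 = 0" if l: "l \<in> {a, b, c}" for l
    proof -
      have el: "e l \<in> V" "T (e l) = l *\<^sub>R e l" "e l \<noteq> 0" using e l by auto
      have xl: "h x (e l) = h (e l) (e l)"
        using l eigenspace_orthogonal[of "e a" a "e b" b] eigenspace_orthogonal[of "e b" b "e a" a]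
          eigenspace_orthogonal[of "e a" a "e c" c] eigenspace_orthogonal[of "e c" c "e a" a]
          eigenspace_orthogonal[of "e c" c "e b" b] eigenspace_orthogonal[of "e b" b "e c" c]
          e(1) distinct
        by (auto simp: x_def h_simps)
      have "h (T x) (e l) = l * h x (e l)" "h (T (T x)) (e l) = l\<^sup>2 * h x (e l)"
        using xV el T_in by (simp_all add: adj h_simps power2_eq_square)
      then have "h (p *\<^sub>R x + q *\<^sub>R T x + r *\<^sub>R T (T x)) (e l) = (p + q * l + r * l\<^sup>2) * h (e l) (e l)"
        by (simp add: h_simps xl algebra_simps)
      with eq pos_h[OF el(1,3)] show ?thesis by (simp add: h_simps)
    qed
    \<comment> \<open>Differences of the equations at two roots; dividing by the distinct roots
      lowers the degree, and a further difference isolates \<open>r\<close>.\<close>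
    have "(a - b) * (q + r * (a + b)) = 0" "(a - c) * (q + r * (a + c)) = 0"
      using root[of a] root[of b] root[of c] by (simp_all add: algebra_simps power2_eq_square)
    then have "q + r * (a + b) = 0" "q + r * (a + c) = 0"
      using distinct by auto
    then have "r * (b - c) = 0" by algebra
    then have "r = 0" using distinct by simp
    with \<open>q + r * (a + b) = 0\<close> root[of a] show ?thesis by simp
  qed
  with xV show ?thesis by blast
qed

text \<open>The relation lives in a space that may have more dimensions than there are coefficients.
  Pairing it with the fixed vectors \<open>c i u0\<close> yields a square system whose matrix at
  \<open>u0\<close> is a Gram matrix, invertible by independence; it stays invertible nearby, where
  Cramer's rule applies.\<close>

lemma continuous_coefficients:
  fixes c :: "'m::finite \<Rightarrow> 'a::euclidean_space \<Rightarrow> 'b::euclidean_space" and y :: "'a \<Rightarrow> real ^ 'm"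
  assumes U: "open U" "u0 \<in> U" and c: "\<And>j. continuous_on U (c j)" and b: "continuous_on U b"
    and indep: "\<And>z :: real ^ 'm. (\<Sum>j\<in>UNIV. z $ j *\<^sub>R c j u0) = 0 \<Longrightarrow> z = 0"
    and sol: "\<And>u. u \<in> U \<Longrightarrow> (\<Sum>j\<in>UNIV. y u $ j *\<^sub>R c j u) = b u"
  shows "isCont y u0"
proof -
  define A :: "'a \<Rightarrow> real ^ 'm ^ 'm" where "A u = (\<chi> i j. c i u0 \<bullet> c j u)" for u
  have mult: "A u *v z = (\<chi> i. c i u0 \<bullet> (\<Sum>j\<in>UNIV. z $ j *\<^sub>R c j u))" for u z
    by (simp add: vec_eq_iff matrix_vector_mult_def A_def inner_sum_right mult.commute)
  have entries: "continuous_on U (\<lambda>u. A u $ i $ j)" for i j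
    by (simp add: A_def continuous_on_inner c)
  have det: "continuous_on U (\<lambda>u. det (A u))"
    using Ck_on_det[of U 0 A] U entries by simp
  have "inj ((*v) (A u0))"
  proof (rule linear_injective_0[THEN iffD2, rule_format])
    fix z assume "A u0 *v z = 0"
    then have z: "c i u0 \<bullet> (\<Sum>j\<in>UNIV. z $ j *\<^sub>R c j u0) = 0" for i
      by (simp add: mult vec_eq_iff)
    have "(\<Sum>i\<in>UNIV. z $ i *\<^sub>R c i u0) \<bullet> (\<Sum>j\<in>UNIV. z $ j *\<^sub>R c j u0) = 0"
      unfolding inner_sum_left[of "\<lambda>i. z $ i *\<^sub>R c i u0"] using z by simp
    then show "z = 0" using indep by simp
  qed (rule matrix_vector_mul_linear)
  then have "det (A u0) \<noteq> 0"
    using matrix_left_invertible_injective invertible_left_inverse invertible_det_nz by blast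
  define W where "W = {u \<in> U. det (A u) \<noteq> 0}"
  have "W = U \<inter> (\<lambda>u. det (A u)) -` (- {0})" by (auto simp: W_def)
  then have W: "open W" "u0 \<in> W" "W \<subseteq> U"
    using U \<open>det (A u0) \<noteq> 0\<close> continuous_open_preimage[OF det U(1), of "- {0}"]
    by (auto simp: W_def)
  have "Ck_on 0 W y"
  proof (rule Ck_on_linear_solution[OF W(1)])
    show "A u *v y u = (\<chi> i. c i u0 \<bullet> b u)" if "u \<in> W" for u
      unfolding mult using that W(3) sol by auto
    show "Ck_on 0 W (\<lambda>x. (\<chi> i. c i u0 \<bullet> b x) $ i)" for i
      using b W(3) by (auto intro!: continuous_on_inner intro: continuous_on_subset)
  qed (use W entries in \<open>auto simp: W_def intro: continuous_on_subset\<close>)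
  with W show ?thesis
    by (simp add: continuous_on_eq_continuous_at)
qed

subsection \<open>Parametrizations\<close>

lemma local_paramD:
  assumes "local_param M \<Omega> \<phi>"
  shows "open \<Omega>" "\<And>k. Ck_on k \<Omega> \<phi>" "\<And>u. u \<in> \<Omega> \<Longrightarrow> inj (frechet_derivative \<phi> (at u))"
    "\<And>u. u \<in> \<Omega> \<Longrightarrow> \<phi> u \<in> M" "openin (top_of_set M) (\<phi> ` \<Omega>)"
    "\<And>u. u \<in> \<Omega> \<Longrightarrow> (\<phi> has_derivative frechet_derivative \<phi> (at u)) (at u)"
  using assms Ck_on_has_derivative[of 0 \<Omega> \<phi>]
  unfolding local_param_def smooth_on_def by blast+

text \<open>Smoothness along a relatively open \<open>U\<close> is tested only in parametrizations
  of \<open>U\<close>, so those of \<open>M\<close> have to be cut down before it can be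
  used.\<close>

lemma local_param_restrict:
  assumes M: "local_param M \<Omega> \<phi>" and U: "openin (top_of_set M) U"
  shows "local_param U (\<Omega> \<inter> \<phi> -` U) \<phi>"
proof -
  let ?W = "\<Omega> \<inter> \<phi> -` U"
  obtain \<psi> where \<psi>: "homeomorphism \<Omega> (\<phi> ` \<Omega>) \<phi> \<psi>"
    using M unfolding local_param_def by blast
  obtain T where T: "open T" "U = M \<inter> T"
    using U by (auto simp: openin_open)
  have "?W = \<Omega> \<inter> \<phi> -` T"
    using local_paramD(4)[OF M] T by auto
  then have W: "open ?W"
    using T continuous_open_preimage[OF homeomorphism_cont1[OF \<psi>] local_paramD(1)[OF M]] by simp
  have "\<phi> ` ?W = \<phi> ` \<Omega> \<inter> U" by auto
  moreover have "openin (top_of_set M) (\<phi> ` \<Omega> \<inter> U)"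
    using local_paramD(5)[OF M] U by blast
  ultimately have "openin (top_of_set U) (\<phi> ` ?W)"
    using T by (auto intro: openin_subset_trans)
  moreover have "homeomorphism ?W (\<phi> ` ?W) \<phi> \<psi>"
    using \<psi> by (rule homeomorphism_of_subsets) auto
  ultimately show ?thesis
    using M W unfolding local_param_def smooth_on_def by (auto intro: Ck_on_subset)
qed

text \<open>A linear left inverse \<open>G\<close> of the differential is a derivative of \<psi>
  within \<open>M\<close>: continuity of \<psi> brings \<open>v\<close> close to \<open>u\<close>,
  and applying \<open>G\<close> to the first-order expansion of \<phi> bounds the error by a small
  multiple of |v - u|, which is then absorbed.\<close>

lemma local_param_inverse_derivative:
  assumes M: "local_param M \<Omega> \<phi>" and \<psi>: "homeomorphism \<Omega> (\<phi> ` \<Omega>) \<phi> \<psi>" and u: "u \<in> \<Omega>"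
  obtains G where "(\<psi> has_derivative G) (at (\<phi> u) within M)"
proof -
  let ?A = "frechet_derivative \<phi> (at u)"
  have der: "(\<phi> has_derivative ?A) (at u)"
    by (rule local_paramD(6)[OF M u])
  then have lin: "linear ?A" by (rule has_derivative_linear)
  obtain G where G: "linear G" "G \<circ> ?A = id"
    using linear_injective_left_inverse[OF lin local_paramD(3)[OF M u]] by blast
  have blG: "bounded_linear G" using G(1) by (simp add: linear_conv_bounded_linear)
  obtain K where K: "K > 0" "\<And>x. norm (G x) \<le> norm x * K"
    using bounded_linear.pos_bounded[OF blG] by blast
  have GA: "G (?A w) = w" for w using G(2) by (metis comp_apply id_apply)
  obtain r where r: "r > 0" "ball (\<phi> u) r \<inter> M \<subseteq> \<phi> ` \<Omega>"
    using local_paramD(5)[OF M] u by (auto simp: openin_contains_ball)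
  have inv: "\<psi> (\<phi> v) = v" if "v \<in> \<Omega>" for v
    using homeomorphism_apply1[OF \<psi> that] .
  have "(\<psi> has_derivative G) (at (\<phi> u) within M)"
    unfolding has_derivative_within_alt
  proof (intro conjI allI impI blG)
    fix e :: real assume e: "e > 0"
    \<comment> \<open>The first bound lets half of |v - u| be absorbed, so that |v - u| is at most 2
      K |\<phi> v - \<phi> u|; the second turns the resulting error factor 2 K^2 \<epsilon> into at
      most \<open>e\<close>.\<close>
    define \<epsilon> where "\<epsilon> = min (1 / (2 * K)) (e / (2 * K\<^sup>2))"
    have \<epsilon>: "\<epsilon> > 0" "K * \<epsilon> \<le> 1 / 2" "K * \<epsilon> * (2 * K) \<le> e"
    proof -
      show "\<epsilon> > 0" using K e by (simp add: \<epsilon>_def)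
      have "K * \<epsilon> \<le> K * (1 / (2 * K))" using K by (intro mult_left_mono) (auto simp: \<epsilon>_def)
      then show "K * \<epsilon> \<le> 1 / 2" using K by simp
      have "K * \<epsilon> * (2 * K) = \<epsilon> * (2 * K\<^sup>2)" by (simp add: power2_eq_square)
      also have "\<dots> \<le> e / (2 * K\<^sup>2) * (2 * K\<^sup>2)"
        by (intro mult_right_mono) (auto simp: \<epsilon>_def)
      finally show "K * \<epsilon> * (2 * K) \<le> e" using K by simp
    qed
    obtain d where d: "d > 0"
      "\<And>v. norm (v - u) < d \<Longrightarrow> norm (\<phi> v - \<phi> u - ?A (v - u)) \<le> \<epsilon> * norm (v - u)"
      using der \<epsilon>(1) unfolding has_derivative_at_alt by blast
    have "continuous (at (\<phi> u) within \<phi> ` \<Omega>) \<psi>"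
      using homeomorphism_cont2[OF \<psi>] u by (auto simp: continuous_on_eq_continuous_within)
    then obtain s where s: "s > 0"
      "\<And>y. y \<in> \<phi> ` \<Omega> \<Longrightarrow> dist y (\<phi> u) < s \<Longrightarrow> dist (\<psi> y) (\<psi> (\<phi> u)) < d"
      using d(1) unfolding continuous_within_eps_delta by blast
    show "\<exists>\<delta>>0. \<forall>y\<in>M. norm (y - \<phi> u) < \<delta> \<longrightarrow> norm (\<psi> y - \<psi> (\<phi> u) - G (y - \<phi> u)) \<le> e * norm (y - \<phi> u)"
    proof (intro exI[of _ "min r s"] conjI ballI impI)
      fix y assume y: "y \<in> M" "norm (y - \<phi> u) < min r s"
      then have "y \<in> \<phi> ` \<Omega>"
        using r(2) by (auto simp: dist_norm norm_minus_commute)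
      then obtain v where v: "v \<in> \<Omega>" "y = \<phi> v" by blast
      have "norm (v - u) < d"
        using s(2)[OF \<open>y \<in> \<phi> ` \<Omega>\<close>] y(2) v u by (simp add: dist_norm inv)
      then have b: "norm (\<phi> v - \<phi> u - ?A (v - u)) \<le> \<epsilon> * norm (v - u)"
        by (rule d(2))
      have eq: "v - u - G (\<phi> v - \<phi> u) = - G (\<phi> v - \<phi> u - ?A (v - u))"
        using GA by (simp add: linear_diff[OF G(1)])
      have "norm (v - u - G (\<phi> v - \<phi> u)) \<le> norm (\<phi> v - \<phi> u - ?A (v - u)) * K"
        unfolding eq norm_minus_cancel by (rule K(2))
      also have "\<dots> \<le> \<epsilon> * norm (v - u) * K"
        using b K(1) by (simp add: mult_right_mono)
      finally have c: "norm (v - u - G (\<phi> v - \<phi> u)) \<le> K * \<epsilon> * norm (v - u)"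
        by (simp add: mult_ac)
      also have "\<dots> \<le> 1 / 2 * norm (v - u)"
        using \<epsilon>(2) by (intro mult_right_mono) auto
      finally have "norm (v - u) \<le> 2 * norm (G (\<phi> v - \<phi> u))"
        using norm_triangle_sub[of "v - u" "G (\<phi> v - \<phi> u)"] by simp
      also have "\<dots> \<le> 2 * (norm (\<phi> v - \<phi> u) * K)"
        using K(2) by simp
      finally have "K * \<epsilon> * norm (v - u) \<le> K * \<epsilon> * (2 * (norm (\<phi> v - \<phi> u) * K))"
        using K(1) \<epsilon>(1) by (intro mult_left_mono) auto
      also have "\<dots> = K * \<epsilon> * (2 * K) * norm (\<phi> v - \<phi> u)" by simp
      also have "\<dots> \<le> e * norm (\<phi> v - \<phi> u)"
        using \<epsilon>(3) by (intro mult_right_mono) auto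
      finally show "norm (\<psi> y - \<psi> (\<phi> u) - G (y - \<phi> u)) \<le> e * norm (y - \<phi> u)"
        using c v u by (simp add: inv)
    qed (use r s in auto)
  qed
  then show ?thesis by (rule that)
qed

text \<open>Near the point \<open>f\<close> factors through \<psi>, so it is differentiable within
  \<open>M\<close>. Whichever derivative within \<open>M\<close> is chosen, the chain rule along
  \<phi> forces its values on tangent vectors.\<close>

lemma along_derivative:
  assumes M: "local_param M \<Omega> \<phi>" and u: "u \<in> \<Omega>" and f: "(f \<circ> \<phi>) differentiable (at u)"
  shows "flat_deriv M f (\<phi> u) (frechet_derivative \<phi> (at u) a) = dir_deriv (f \<circ> \<phi>) a u"
proof -
  obtain \<psi> where \<psi>: "homeomorphism \<Omega> (\<phi> ` \<Omega>) \<phi> \<psi>"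
    using M unfolding local_param_def by blast
  obtain G where G: "(\<psi> has_derivative G) (at (\<phi> u) within M)"
    using local_param_inverse_derivative[OF M \<psi> u] .
  have inv: "\<psi> (\<phi> u) = u" using homeomorphism_apply1[OF \<psi> u] .
  obtain r where r: "r > 0" "ball (\<phi> u) r \<inter> M \<subseteq> \<phi> ` \<Omega>"
    using local_paramD(5)[OF M] u by (auto simp: openin_contains_ball)
  have f': "((f \<circ> \<phi>) has_derivative frechet_derivative (f \<circ> \<phi>) (at u)) (at u)"
    using f by (simp add: frechet_derivative_works)
  have "((\<lambda>y. (f \<circ> \<phi>) (\<psi> y)) has_derivative (\<lambda>v. frechet_derivative (f \<circ> \<phi>) (at u) (G v)))
      (at (\<phi> u) within M)"
    using has_derivative_compose[OF G] f' inv by metis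
  then have "(f has_derivative (\<lambda>v. frechet_derivative (f \<circ> \<phi>) (at u) (G v))) (at (\<phi> u) within M)"
  proof (rule has_derivative_transform_within[OF _ r(1)])
    fix y assume "y \<in> M" "dist y (\<phi> u) < r"
    then have "y \<in> \<phi> ` \<Omega>" using r(2) by (auto simp: dist_commute)
    then show "(f \<circ> \<phi>) (\<psi> y) = f y"
      using homeomorphism_apply2[OF \<psi>] by simp
  qed (use local_paramD(4)[OF M u] in auto)
  \<comment> \<open>Passes from the derivative just constructed to the chosen one; the two may
    differ off the tangent space.\<close>
  then have "(f has_derivative frechet_derivative f (at (\<phi> u) within M)) (at (\<phi> u) within M)"
    using frechet_derivative_works differentiableI by blast
  then have fM: "(f has_derivative frechet_derivative f (at (\<phi> u) within M)) (at (\<phi> u) within \<phi> ` \<Omega>)"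
    using local_paramD(4)[OF M] by (auto intro: has_derivative_subset)
  have \<phi>: "(\<phi> has_derivative frechet_derivative \<phi> (at u)) (at u within \<Omega>)"
    using local_paramD(6)[OF M u] by (rule has_derivative_at_withinI)
  have "((f \<circ> \<phi>) has_derivative frechet_derivative f (at (\<phi> u) within M) \<circ> frechet_derivative \<phi> (at u))
      (at u)"
    using diff_chain_within[OF \<phi> fM] at_within_open[OF u local_paramD(1)[OF M]] by simp
  from frechet_derivative_at[OF this] show ?thesis
    unfolding flat_deriv_def by (metis comp_apply)
qed

text \<open>Any other parametrization factors near the point as \<phi> after a differentiable change
  of parameters, so its differential has its range inside that of \<phi>.\<close>

lemma tangent_space_param:
  assumes M: "local_param M \<Omega> \<phi>" and u: "u \<in> \<Omega>"
  shows "tangent_space M (\<phi> u) = range (frechet_derivative \<phi> (at u))"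
proof
  show "range (frechet_derivative \<phi> (at u)) \<subseteq> tangent_space M (\<phi> u)"
    using M u by (auto simp: tangent_space_def)
  show "tangent_space M (\<phi> u) \<subseteq> range (frechet_derivative \<phi> (at u))"
  proof
    fix v assume "v \<in> tangent_space M (\<phi> u)"
    then obtain \<Omega>' \<phi>' u' w where M': "local_param M \<Omega>' \<phi>'" and u': "u' \<in> \<Omega>'" "\<phi>' u' = \<phi> u"
      and v: "v = frechet_derivative \<phi>' (at u') w"
      unfolding tangent_space_def by blast
    let ?D = "frechet_derivative \<phi> (at u)" and ?D' = "frechet_derivative \<phi>' (at u')"
    obtain \<psi> where \<psi>: "homeomorphism \<Omega> (\<phi> ` \<Omega>) \<phi> \<psi>"
      using M unfolding local_param_def by blast
    obtain G where "(\<psi> has_derivative G) (at (\<phi> u) within M)"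
      using local_param_inverse_derivative[OF M \<psi> u] .
    then have G: "(\<psi> has_derivative G) (at (\<phi>' u') within \<phi>' ` \<Omega>')"
      unfolding u'(2) using local_paramD(4)[OF M'] by (auto intro: has_derivative_subset)
    have \<phi>': "(\<phi>' has_derivative ?D') (at u' within \<Omega>')"
      using local_paramD(6)[OF M' u'(1)] by (rule has_derivative_at_withinI)
    have "((\<psi> \<circ> \<phi>') has_derivative G \<circ> ?D') (at u')"
      using diff_chain_within[OF \<phi>' G] at_within_open[OF u'(1) local_paramD(1)[OF M']] by simp
    moreover have "(\<phi> has_derivative ?D) (at ((\<psi> \<circ> \<phi>') u'))"
      using local_paramD(6)[OF M u] homeomorphism_apply1[OF \<psi> u] u'(2) by simp
    ultimately have "(\<phi> \<circ> (\<psi> \<circ> \<phi>') has_derivative ?D \<circ> (G \<circ> ?D')) (at u')"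
      by (rule diff_chain_at)
    moreover have "open (\<Omega>' \<inter> \<phi>' -` (\<phi> ` \<Omega>))"
      using local_paramD(1)[OF local_param_restrict[OF M' local_paramD(5)[OF M]]] .
    ultimately have "(\<phi>' has_derivative ?D \<circ> (G \<circ> ?D')) (at u')"
    proof (rule has_derivative_transform_within_open)
      show "u' \<in> \<Omega>' \<inter> \<phi>' -` (\<phi> ` \<Omega>)" using u u' by auto
      fix z assume "z \<in> \<Omega>' \<inter> \<phi>' -` (\<phi> ` \<Omega>)"
      then show "(\<phi> \<circ> (\<psi> \<circ> \<phi>')) z = \<phi>' z"
        using homeomorphism_apply2[OF \<psi>] by simp
    qed
    from frechet_derivative_at[OF this] have "?D' w = ?D (G (?D' w))"
      by (metis comp_apply)
    then show "v \<in> range ?D" unfolding v by (rule range_eqI)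
  qed
qed

lemma matrix_inv_inverse:
  assumes "invertible A"
  shows "matrix_inv A ** A = mat 1" "A ** matrix_inv A = mat 1"
  using someI_ex[OF assms[unfolded invertible_def]] by (simp_all add: matrix_inv_def)

subsection \<open>The frame of an affine normal in a parametrization\<close>

locale normal_chart =
  fixes M :: "(real ^ ('n::finite option)) set" and \<xi> :: "real ^ ('n option) \<Rightarrow> real ^ ('n option)"
    and \<Omega> :: "(real ^ 'n) set" and \<phi> :: "real ^ 'n \<Rightarrow> real ^ ('n option)"
  assumes param: "local_param M \<Omega> \<phi>" and normal: "affine_normal M \<xi>"
begin

abbreviation D\<phi> :: "real ^ 'n \<Rightarrow> real ^ 'n \<Rightarrow> real ^ ('n option)" where
  "D\<phi> u \<equiv> frechet_derivative \<phi> (at u)"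

abbreviation D\<xi> :: "real ^ 'n \<Rightarrow> real ^ 'n \<Rightarrow> real ^ ('n option)" where
  "D\<xi> u \<equiv> frechet_derivative (\<xi> \<circ> \<phi>) (at u)"

lemmas param_facts = local_paramD[OF param]
lemmas open_\<Omega> = param_facts(1)
lemmas tangent_eq = tangent_space_param[OF param]

lemma smooth_\<xi>: "Ck_on k \<Omega> (\<xi> \<circ> \<phi>)"
  using normal param unfolding affine_normal_def smooth_along_def smooth_on_def by blast

lemma smooth_D: "Ck_on k \<Omega> (dir_deriv \<phi> a)" "Ck_on k \<Omega> (dir_deriv (\<xi> \<circ> \<phi>) a)"
  using param_facts(2)[of "Suc k"] smooth_\<xi>[of "Suc k"] by auto

lemma \<xi>_has_derivative: "u \<in> \<Omega> \<Longrightarrow> ((\<xi> \<circ> \<phi>) has_derivative D\<xi> u) (at u)"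
  using Ck_on_has_derivative[OF smooth_\<xi>] .

lemma linear_D\<phi>: "u \<in> \<Omega> \<Longrightarrow> linear (D\<phi> u)"
  using param_facts(6) has_derivative_linear by blast

lemma linear_D\<xi>: "u \<in> \<Omega> \<Longrightarrow> linear (D\<xi> u)"
  using \<xi>_has_derivative has_derivative_linear by blast

text \<open>The frame vectors are rows, so that \<open>frame u *v z\<close> lists the inner products
  of \<open>z\<close> with them and the dual frame consists of the columns of the inverse.\<close>

definition frame :: "real ^ 'n \<Rightarrow> real ^ ('n option) ^ ('n option)" where
  "frame u = (\<chi> j. case j of None \<Rightarrow> \<xi> (\<phi> u) | Some k \<Rightarrow> D\<phi> u (axis k 1))"

lemma frame_nth: "frame u $ None = \<xi> (\<phi> u)" "frame u $ Some k = D\<phi> u (axis k 1)"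
  by (simp_all add: frame_def)

lemma D\<phi>_expansion:
  assumes "u \<in> \<Omega>"
  shows "D\<phi> u a = (\<Sum>k\<in>UNIV. a $ k *\<^sub>R D\<phi> u (axis k 1))"
proof -
  have "a = (\<Sum>k\<in>UNIV. a $ k *\<^sub>R axis k 1)"
    using basis_expansion[of a] by (simp add: scalar_mult_eq_scaleR)
  then have "D\<phi> u a = D\<phi> u (\<Sum>k\<in>UNIV. a $ k *\<^sub>R axis k 1)" by simp
  then show ?thesis
    by (simp add: linear_sum[OF linear_D\<phi>[OF assms]] linear_scale[OF linear_D\<phi>[OF assms]])
qed

lemma sum_option: "(\<Sum>j\<in>(UNIV :: 'n option set). f j) = f None + (\<Sum>k\<in>UNIV. f (Some k))"
  by (simp add: UNIV_option_conv sum.reindex)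

text \<open>In a vanishing combination of the rows, transversality of \<xi> kills the coefficient of
  \<xi>, and injectivity of the differential the others.\<close>

lemma invertible_frame:
  assumes u: "u \<in> \<Omega>"
  shows "invertible (frame u)"
  unfolding invertible_right_inverse matrix_right_invertible_independent_rows
proof (intro allI impI)
  fix c :: "'n option \<Rightarrow> real" and i
  assume "(\<Sum>j\<in>UNIV. c j *s row j (frame u)) = 0"
  moreover have "(\<Sum>j\<in>UNIV. c j *s row j (frame u)) = c None *\<^sub>R \<xi> (\<phi> u) + D\<phi> u (\<chi> k. c (Some k))"
    unfolding sum_option D\<phi>_expansion[OF u, of "\<chi> k. c (Some k)"]
    by (simp add: row_def frame_nth vec_lambda_eta scalar_mult_eq_scaleR)
  ultimately have eq: "c None *\<^sub>R \<xi> (\<phi> u) + D\<phi> u (\<chi> k. c (Some k)) = 0" by simp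
  have None: "c None = 0"
  proof (rule ccontr)
    assume ne: "c None \<noteq> 0"
    have "c None *\<^sub>R \<xi> (\<phi> u) = - D\<phi> u (\<chi> k. c (Some k))"
      using eq by (simp add: eq_neg_iff_add_eq_0)
    then have "(1 / c None) *\<^sub>R c None *\<^sub>R \<xi> (\<phi> u) = (1 / c None) *\<^sub>R (- D\<phi> u (\<chi> k. c (Some k)))"
      by simp
    also have "\<dots> = D\<phi> u ((- 1 / c None) *\<^sub>R (\<chi> k. c (Some k)))"
      using linear_scale[OF linear_D\<phi>[OF u], of "- 1 / c None"] by simp
    finally have "\<xi> (\<phi> u) \<in> tangent_space M (\<phi> u)"
      using ne unfolding tangent_eq[OF u] by simp
    then show False
      using normal param_facts(4)[OF u] by (auto simp: affine_normal_def)
  qed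
  then have "D\<phi> u (\<chi> k. c (Some k)) = D\<phi> u 0"
    using eq linear_0[OF linear_D\<phi>[OF u]] by simp
  then have "(\<chi> k. c (Some k)) = 0"
    using param_facts(3)[OF u] by (auto dest: injD)
  then have "c (Some k) = 0" for k by (simp add: vec_eq_iff)
  with None show "c i = 0" by (cases i) auto
qed

definition dual :: "'n option \<Rightarrow> real ^ 'n \<Rightarrow> real ^ ('n option)" where
  "dual j u = matrix_inv (frame u) *v axis j 1"

abbreviation conormal :: "real ^ 'n \<Rightarrow> real ^ ('n option)" where
  "conormal \<equiv> dual None"

lemma frame_dual:
  assumes "u \<in> \<Omega>"
  shows "frame u *v dual j u = axis j 1"
  using matrix_inv_inverse(2)[OF invertible_frame[OF assms]]
  by (simp add: dual_def matrix_vector_mul_assoc)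

lemma conormal_\<xi>: "u \<in> \<Omega> \<Longrightarrow> \<xi> (\<phi> u) \<bullet> conormal u = 1"
  using frame_dual[of u None] by (simp add: vec_eq_iff matrix_vector_mul_component frame_nth axis_def)
    (metis frame_nth(1))

lemma conormal_D\<phi>:
  assumes "u \<in> \<Omega>"
  shows "D\<phi> u a \<bullet> conormal u = 0"
proof -
  have "D\<phi> u (axis k 1) \<bullet> conormal u = 0" for k
    using arg_cong[OF frame_dual[OF assms, of None], of "\<lambda>v. v $ Some k"]
    by (simp add: matrix_vector_mul_component frame_nth axis_def)
  then show ?thesis
    by (simp add: D\<phi>_expansion[OF assms, of a] inner_sum_left)
qed

lemma dual_expansion:
  assumes "u \<in> \<Omega>"
  shows "z = (z \<bullet> conormal u) *\<^sub>R \<xi> (\<phi> u) + (\<Sum>k\<in>UNIV. (z \<bullet> dual (Some k) u) *\<^sub>R D\<phi> u (axis k 1))"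
proof -
  have "z = (z v* matrix_inv (frame u)) v* frame u"
    using matrix_inv_inverse(1)[OF invertible_frame[OF assms]] by (simp add: vector_matrix_mul_assoc)
  also have "\<dots> = (\<Sum>j\<in>UNIV. (z v* matrix_inv (frame u)) $ j *\<^sub>R frame u $ j)"
    by (simp add: vec_eq_iff vector_matrix_mult_def mult.commute)
  also have "\<dots> = (\<Sum>j\<in>UNIV. (z \<bullet> dual j u) *\<^sub>R frame u $ j)"
    by (simp add: dual_def dot_lmul_matrix[symmetric] inner_axis)
  finally show ?thesis by (simp add: sum_option frame_nth)
qed

text \<open>Turns tangency into an equation that can be differentiated.\<close>

lemma tangent_iff:
  assumes u: "u \<in> \<Omega>"
  shows "z \<in> tangent_space M (\<phi> u) \<longleftrightarrow> z \<bullet> conormal u = 0"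
proof
  assume "z \<bullet> conormal u = 0"
  then have "z = D\<phi> u (\<chi> k. z \<bullet> dual (Some k) u)"
    using dual_expansion[OF u, of z] by (simp add: D\<phi>_expansion[OF u, of "\<chi> k. _ k"])
  then show "z \<in> tangent_space M (\<phi> u)" unfolding tangent_eq[OF u] by (rule range_eqI)
qed (auto simp: tangent_eq[OF u] conormal_D\<phi>[OF u])

lemma tangent_expansion:
  "u \<in> \<Omega> \<Longrightarrow> z \<in> tangent_space M (\<phi> u) \<Longrightarrow> (\<Sum>k\<in>UNIV. (z \<bullet> dual (Some k) u) *\<^sub>R D\<phi> u (axis k 1)) = z"
  using dual_expansion[of u z] tangent_iff[of u z] by simp

lemma smooth_dual: "Ck_on k \<Omega> (dual j)"
proof (rule Ck_on_linear_solution[OF open_\<Omega>])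
  show "Ck_on k \<Omega> (\<lambda>u. frame u $ i $ l)" for i l
    using smooth_D(1)[of k] smooth_\<xi>[of k]
    by (cases i) (auto simp: frame_nth comp_def intro!: Ck_on_vec_nth[OF open_\<Omega>])
  show "Ck_on k \<Omega> (\<lambda>x. axis j 1 $ i)" for i by simp
  show "det (frame u) \<noteq> 0" if "u \<in> \<Omega>" for u
    using invertible_frame[OF that] invertible_det_nz by blast
qed (rule frame_dual)

lemma dual_differentiable: "u \<in> \<Omega> \<Longrightarrow> dual j differentiable (at u)"
  using smooth_dual[of "Suc 0"] by simp

lemma linear_D_conormal: "u \<in> \<Omega> \<Longrightarrow> linear (frechet_derivative conormal (at u))"
  using dual_differentiable frechet_derivative_works has_derivative_linear by blast

lemma conormal_derivative:
  assumes W: "open W" "u \<in> W" "W \<subseteq> \<Omega>" and Y: "Y differentiable (at u)"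
    and tang: "\<And>v. v \<in> W \<Longrightarrow> Y v \<in> tangent_space M (\<phi> v)"
  shows "dir_deriv Y a u \<bullet> conormal u = - (Y u \<bullet> dir_deriv conormal a u)"
proof -
  have u: "u \<in> \<Omega>" using W by auto
  have "frechet_derivative (\<lambda>v. Y v \<bullet> conormal v) (at u) = frechet_derivative (\<lambda>v. 0 :: real) (at u)"
    using W tang by (intro frechet_derivative_cong_open[of W]) (auto simp: tangent_iff[symmetric] subset_eq)
  then have "dir_deriv (\<lambda>v. Y v \<bullet> conormal v) a u = 0" by simp
  then show ?thesis
    using dir_deriv_inner[OF Y dual_differentiable[of u None, OF u], of a] by simp
qed

lemma projection_coefficient:
  assumes "u \<in> \<Omega>"
  shows "(THE k. w - k *\<^sub>R \<xi> (\<phi> u) \<in> tangent_space M (\<phi> u)) = w \<bullet> conormal u"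
  by (rule the_equality) (simp_all add: tangent_iff[OF assms] inner_diff_left conormal_\<xi>[OF assms])

lemma smooth_projection:
  "smooth_on \<Omega> ((\<lambda>y. w - (THE k. w - k *\<^sub>R \<xi> y \<in> tangent_space M y) *\<^sub>R \<xi> y) \<circ> \<phi>)"
  unfolding smooth_on_def
proof (intro conjI allI open_\<Omega>)
  fix k
  have "Ck_on k \<Omega> (\<lambda>u. w + (- 1 * (w \<bullet> conormal u)) *\<^sub>R (\<xi> \<circ> \<phi>) u)"
    by (intro Ck_on_add Ck_on_scaleR Ck_on_mult Ck_on_inner open_\<Omega> Ck_on_const smooth_dual smooth_\<xi>)
  then show "Ck_on k \<Omega> ((\<lambda>y. w - (THE k. w - k *\<^sub>R \<xi> y \<in> tangent_space M y) *\<^sub>R \<xi> y) \<circ> \<phi>)"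
    by (rule Ck_on_cong[OF open_\<Omega>]) (simp add: projection_coefficient)
qed

end

text \<open>The projection of a constant vector along \<open>\<xi>\<close> does not refer to a parametrization, so its
  smoothness needs no transition maps.\<close>

lemma local_tangent_field_exists:
  assumes M: "hypersurface M" "affine_normal M \<xi>" and x: "x \<in> M" and w: "w \<in> tangent_space M x"
  shows "\<exists>Y. local_tangent_field M M Y \<and> Y x = w"
proof -
  define \<kappa> where "\<kappa> y = (THE k. w - k *\<^sub>R \<xi> y \<in> tangent_space M y)" for y
  define Y where "Y y = w - \<kappa> y *\<^sub>R \<xi> y" for y
  have chart: "normal_chart M \<xi> \<Omega> \<phi>" if "local_param M \<Omega> \<phi>" for \<Omega> \<phi>
    using that M(2) by unfold_locales
  have "smooth_along M Y"
    unfolding smooth_along_def Y_def[abs_def] \<kappa>_def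
    using normal_chart.smooth_projection[OF chart] by blast
  moreover have "Y y \<in> tangent_space M y" if y: "y \<in> M" for y
  proof -
    obtain \<Omega> \<phi> u where p: "local_param M \<Omega> \<phi>" "u \<in> \<Omega>" "y = \<phi> u"
      using M(1) y unfolding hypersurface_def by blast
    interpret normal_chart M \<xi> \<Omega> \<phi> by (rule chart[OF p(1)])
    show ?thesis
      using p(2) by (simp add: p(3) Y_def \<kappa>_def projection_coefficient tangent_iff inner_diff_left conormal_\<xi>)
  qed
  moreover have "Y x = w"
  proof -
    obtain \<Omega> \<phi> u where p: "local_param M \<Omega> \<phi>" "u \<in> \<Omega>" "x = \<phi> u"
      using M(1) x unfolding hypersurface_def by blast
    interpret normal_chart M \<xi> \<Omega> \<phi> by (rule chart[OF p(1)])
    have "w \<bullet> conormal u = 0" using w p tangent_iff by blast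
    then show ?thesis
      using p(2) by (simp add: p(3) Y_def \<kappa>_def projection_coefficient)
  qed
  ultimately show ?thesis by (auto simp: local_tangent_field_def)
qed

context normal_chart
begin

lemma flat_deriv_param:
  assumes U: "openin (top_of_set M) U" "\<phi> u \<in> U" and Y: "smooth_along U Y" and u: "u \<in> \<Omega>"
  shows "(Y \<circ> \<phi>) differentiable (at u)"
    and "flat_deriv M Y (\<phi> u) (D\<phi> u a) = dir_deriv (Y \<circ> \<phi>) a u"
proof -
  have "Ck_on (Suc 0) (\<Omega> \<inter> \<phi> -` U) (Y \<circ> \<phi>)"
    using Y local_param_restrict[OF param U(1)] unfolding smooth_along_def smooth_on_def by blast
  then show "(Y \<circ> \<phi>) differentiable (at u)" using u U(2) by simp
  then show "flat_deriv M Y (\<phi> u) (D\<phi> u a) = dir_deriv (Y \<circ> \<phi>) a u"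
    by (rule along_derivative[OF param u])
qed

text \<open>The right-hand side involves a tangent field only through its value at the point, so all
  fields that occur in the description of the fundamental form give the same number.\<close>

lemma blaschke_metric_param:
  assumes hyp: "hypersurface M" and u: "u \<in> \<Omega>" and w: "w \<in> tangent_space M (\<phi> u)"
  shows "blaschke_metric M \<xi> (\<phi> u) (D\<phi> u a) w = - (w \<bullet> dir_deriv conormal a u)"
proof -
  let ?c = "- (w \<bullet> dir_deriv conormal a u)"
  have key: "flat_deriv M Y (\<phi> u) (D\<phi> u a) \<bullet> conormal u = ?c"
    if Y: "local_tangent_field M U Y" "\<phi> u \<in> U" "Y (\<phi> u) = w" for U Y
  proof -
    have U: "openin (top_of_set M) U" and sm: "smooth_along U Y"
      and tang: "\<And>y. y \<in> U \<Longrightarrow> Y y \<in> tangent_space M y"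
      using Y(1) by (auto simp: local_tangent_field_def)
    have "open (\<Omega> \<inter> \<phi> -` U)"
      using local_paramD(1)[OF local_param_restrict[OF param U]] .
    then have "dir_deriv (Y \<circ> \<phi>) a u \<bullet> conormal u = - ((Y \<circ> \<phi>) u \<bullet> dir_deriv conormal a u)"
      using flat_deriv_param(1)[OF U Y(2) sm u] tang u Y(2)
      by (intro conormal_derivative[of "\<Omega> \<inter> \<phi> -` U"]) auto
    then show ?thesis
      using flat_deriv_param(2)[OF U Y(2) sm u, of a] Y(3) by simp
  qed
  have iff: "flat_deriv M Y (\<phi> u) (D\<phi> u a) - c *\<^sub>R \<xi> (\<phi> u) \<in> tangent_space M (\<phi> u) \<longleftrightarrow> c = ?c"
    if "local_tangent_field M U Y" "\<phi> u \<in> U" "Y (\<phi> u) = w" for U Y c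
    using key[OF that] by (auto simp: tangent_iff[OF u] inner_diff_left conormal_\<xi>[OF u])
  \<comment> \<open>Uniqueness needs at least one field through \<open>w\<close>; otherwise every
    real number would satisfy the description vacuously.\<close>
  obtain Y0 where "local_tangent_field M M Y0" "Y0 (\<phi> u) = w"
    using local_tangent_field_exists[OF hyp normal param_facts(4)[OF u] w] by blast
  then show ?thesis
    unfolding blaschke_metric_def affine_fundamental_form_def
    using iff param_facts(4)[OF u] by (intro the_equality) blast+
qed

lemma metric_D\<phi>:
  assumes "hypersurface M" and u: "u \<in> \<Omega>"
  shows "blaschke_metric M \<xi> (\<phi> u) (D\<phi> u a) (D\<phi> u b)
    = dir_deriv (dir_deriv \<phi> b) a u \<bullet> conormal u"
proof -
  have "dir_deriv \<phi> b differentiable (at u)"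
    using smooth_D(1)[of "Suc 0" b] u by simp
  then have "dir_deriv (dir_deriv \<phi> b) a u \<bullet> conormal u = - (D\<phi> u b \<bullet> dir_deriv conormal a u)"
    by (rule conormal_derivative[OF open_\<Omega> u order_refl]) (auto simp: tangent_eq)
  then show ?thesis
    using blaschke_metric_param[OF assms, of "D\<phi> u b" a] by (simp add: tangent_eq[OF u])
qed

lemma shape_D\<phi>:
  assumes u: "u \<in> \<Omega>"
  shows "shape_operator M \<xi> (\<phi> u) (D\<phi> u a) = - D\<xi> u a"
    and "D\<xi> u a \<in> tangent_space M (\<phi> u)"
proof -
  have "smooth_along M \<xi>" using normal by (simp add: affine_normal_def)
  then have *: "flat_deriv M \<xi> (\<phi> u) (D\<phi> u a) = D\<xi> u a"
    using flat_deriv_param(2)[OF openin_subtopology_self _ _ u, of \<xi>] param_facts(4)[OF u] by simp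
  then show "shape_operator M \<xi> (\<phi> u) (D\<phi> u a) = - D\<xi> u a"
    by (simp add: shape_operator_def)
  have "D\<phi> u a \<in> tangent_space M (\<phi> u)" by (simp add: tangent_eq[OF u])
  then show "D\<xi> u a \<in> tangent_space M (\<phi> u)"
    using normal param_facts(4)[OF u] unfolding affine_normal_def *[symmetric] by blast
qed

lemma metric_D\<phi>_D\<xi>:
  assumes "hypersurface M" and u: "u \<in> \<Omega>"
  shows "blaschke_metric M \<xi> (\<phi> u) (D\<phi> u a) (D\<xi> u b)
    = dir_deriv (dir_deriv (\<xi> \<circ> \<phi>) b) a u \<bullet> conormal u"
proof -
  have "dir_deriv (\<xi> \<circ> \<phi>) b differentiable (at u)"
    using smooth_D(2)[of "Suc 0" b] u by simp
  then have "dir_deriv (dir_deriv (\<xi> \<circ> \<phi>) b) a u \<bullet> conormal u = - (D\<xi> u b \<bullet> dir_deriv conormal a u)"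
    by (rule conormal_derivative[OF open_\<Omega> u order_refl]) (rule shape_D\<phi>(2))
  then show ?thesis
    using blaschke_metric_param[OF assms shape_D\<phi>(2)[OF u]] by simp
qed

text \<open>A left inverse \<open>G\<close> of the differential extends both objects linearly to the
  ambient space: \<open>h\<close> from the derivative of the conormal and \<open>T\<close> from that
  of \<xi>.\<close>

lemma self_adjoint_exists:
  assumes hyp: "hypersurface M" and pos: "positively_oriented M \<xi>" and u: "u \<in> \<Omega>"
  shows "\<exists>h T. self_adjoint_on (tangent_space M (\<phi> u)) h T \<and>
    (\<forall>x\<in>tangent_space M (\<phi> u). T x = shape_operator M \<xi> (\<phi> u) x \<and>
      (\<forall>y\<in>tangent_space M (\<phi> u). h x y = blaschke_metric M \<xi> (\<phi> u) x y))"
proof -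
  let ?V = "tangent_space M (\<phi> u)" and ?g = "blaschke_metric M \<xi> (\<phi> u)"
  obtain G where G: "linear G" "G \<circ> D\<phi> u = id"
    using linear_injective_left_inverse[OF linear_D\<phi>[OF u] param_facts(3)[OF u]] by blast
  have GD: "G (D\<phi> u a) = a" for a using G(2) by (metis comp_apply id_apply)
  define h where "h x y = - (y \<bullet> frechet_derivative conormal (at u) (G x))" for x y
  define T where "T x = - D\<xi> u (G x)" for x
  have h: "h x y = ?g x y" if "x \<in> ?V" "y \<in> ?V" for x y
    using that(1) blaschke_metric_param[OF hyp u that(2)] unfolding tangent_eq[OF u]
    by (auto simp: h_def GD)
  have T: "T x = shape_operator M \<xi> (\<phi> u) x" if "x \<in> ?V" for x
    using that shape_D\<phi>(1)[OF u] unfolding tangent_eq[OF u] by (auto simp: T_def GD)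
  have lT: "linear T"
    using linear_compose_neg[OF linear_compose[OF G(1) linear_D\<xi>[OF u]]] by (simp add: T_def[abs_def] comp_def)
  have TV: "T x \<in> ?V" for x
    using shape_D\<phi>(2)[OF u] by (simp add: T_def tangent_iff[OF u])
  have bil: "bilinear h"
    using linear_add[OF linear_D_conormal[OF u]] linear_scale[OF linear_D_conormal[OF u]]
      linear_add[OF G(1)] linear_scale[OF G(1)] unfolding bilinear_def h_def
    by (auto intro!: linearI simp: inner_add_right inner_add_left)
  have sub: "subspace ?V"
    by (auto simp: subspace_def tangent_iff[OF u] inner_add_left)
  have sym: "h x y = h y x" if xy: "x \<in> ?V" "y \<in> ?V" for x y
  proof -
    obtain a b where "x = D\<phi> u a" "y = D\<phi> u b" using xy unfolding tangent_eq[OF u] by blast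
    then show ?thesis
      using metric_D\<phi>[OF hyp u] dir_deriv_commute[OF param_facts(2) open_\<Omega> u] h xy by simp
  qed
  \<comment> \<open>The Ricci equation: both sides are the conormal component of a mixed second
    derivative of \<xi> along \<phi>, up to sign.\<close>
  have adj: "h x (T y) = h y (T x)" if xy: "x \<in> ?V" "y \<in> ?V" for x y
  proof -
    obtain a b where ab: "x = D\<phi> u a" "y = D\<phi> u b" using xy unfolding tangent_eq[OF u] by blast
    have "h (D\<phi> u c) (T (D\<phi> u d)) = - ?g (D\<phi> u c) (D\<xi> u d)" for c d
    proof -
      have "h (D\<phi> u c) (T (D\<phi> u d)) = - h (D\<phi> u c) (D\<xi> u d)"
        by (simp add: h_def T_def GD)
      then show ?thesis using h shape_D\<phi>(2)[OF u] by (simp add: tangent_eq[OF u])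
    qed
    then show ?thesis
      using metric_D\<phi>_D\<xi>[OF hyp u] dir_deriv_commute[OF smooth_\<xi> open_\<Omega> u] unfolding ab by simp
  qed
  have "self_adjoint_on ?V h T"
  proof (intro self_adjoint_on.intro form_on.intro self_adjoint_on_axioms.intro)
    show "h x x > 0" if "x \<in> ?V" "x \<noteq> 0" for x
      using pos that h param_facts(4)[OF u] by (simp add: positively_oriented_def)
    show "h (T x) y = h x (T y)" if "x \<in> ?V" "y \<in> ?V" for x y
      using adj[OF that] sym[OF TV that(2)] by simp
  qed (rule sub bil sym lT TV; assumption)+
  with h T show ?thesis by blast
qed

end

subsection \<open>Three principal curvatures\<close>

lemma (in self_adjoint_on) three_eigenvaluesI:
  assumes "a \<noteq> b" "a \<noteq> c" "b \<noteq> c" "{l. \<exists>v\<in>V. v \<noteq> 0 \<and> T v = l *\<^sub>R v} = {a, b, c}"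
  shows "three_eigenvalues V h T a b c"
  using assms by unfold_locales

context normal_chart
begin

lemma three_eigenvalues_exist:
  assumes "hypersurface M" "positively_oriented M \<xi>" "u \<in> \<Omega>"
    and "a \<noteq> b" "a \<noteq> c" "b \<noteq> c" "principal_curvatures M \<xi> (\<phi> u) = {a, b, c}"
  obtains h T where "three_eigenvalues (tangent_space M (\<phi> u)) h T a b c"
    "\<And>x. x \<in> tangent_space M (\<phi> u) \<Longrightarrow> T x = shape_operator M \<xi> (\<phi> u) x"
    "\<And>x y. x \<in> tangent_space M (\<phi> u) \<Longrightarrow> y \<in> tangent_space M (\<phi> u) \<Longrightarrow>
      h x y = blaschke_metric M \<xi> (\<phi> u) x y"
proof -
  obtain h T where sa: "self_adjoint_on (tangent_space M (\<phi> u)) h T"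
    and T: "\<And>x. x \<in> tangent_space M (\<phi> u) \<Longrightarrow> T x = shape_operator M \<xi> (\<phi> u) x"
    and h: "\<And>x y. x \<in> tangent_space M (\<phi> u) \<Longrightarrow> y \<in> tangent_space M (\<phi> u) \<Longrightarrow>
      h x y = blaschke_metric M \<xi> (\<phi> u) x y"
    using self_adjoint_exists[OF assms(1-3)] by metis
  have "{l. \<exists>v\<in>tangent_space M (\<phi> u). v \<noteq> 0 \<and> T v = l *\<^sub>R v} = {a, b, c}"
    unfolding assms(7)[symmetric] principal_curvatures_def using T by auto
  then have "three_eigenvalues (tangent_space M (\<phi> u)) h T a b c"
    by (intro self_adjoint_on.three_eigenvaluesI[OF sa] assms(4-6))
  then show ?thesis using T h by (rule that)
qed

text \<open>The operators \<open>T\<close> are obtained separately at each point and carry no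
  continuity in \<open>u\<close>; this formula in the dual frame agrees with them on tangent vectors
  and is visibly continuous.\<close>

definition shape_ext :: "real ^ 'n \<Rightarrow> real ^ ('n option) \<Rightarrow> real ^ ('n option)" where
  "shape_ext u z = - (\<Sum>k\<in>UNIV. (z \<bullet> dual (Some k) u) *\<^sub>R D\<xi> u (axis k 1))"

lemma shape_ext_eq:
  assumes u: "u \<in> \<Omega>" and T: "linear T" "\<And>x. x \<in> tangent_space M (\<phi> u) \<Longrightarrow> T x = shape_operator M \<xi> (\<phi> u) x"
    and z: "z \<in> tangent_space M (\<phi> u)"
  shows "T z = shape_ext u z"
proof -
  have "T (D\<phi> u a) = - D\<xi> u a" for a
    using T(2) shape_D\<phi>(1)[OF u] by (simp add: tangent_eq[OF u])
  then have "T (\<Sum>k\<in>UNIV. (z \<bullet> dual (Some k) u) *\<^sub>R D\<phi> u (axis k 1)) = shape_ext u z"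
    by (simp add: shape_ext_def linear_sum[OF T(1)] linear_scale[OF T(1)] sum_negf)
  then show ?thesis using tangent_expansion[OF u z] by simp
qed

lemma continuous_dual: "continuous_on \<Omega> (dual j)"
  using smooth_dual[of 0] by simp

lemma continuous_D: "continuous_on \<Omega> (dir_deriv \<phi> a)" "continuous_on \<Omega> (dir_deriv (\<xi> \<circ> \<phi>) a)"
  using smooth_D[of 0] by simp_all

lemma continuous_shape_ext:
  "continuous_on \<Omega> z \<Longrightarrow> continuous_on \<Omega> (\<lambda>u. shape_ext u (z u))"
  unfolding shape_ext_def
  by (intro continuous_on_minus continuous_on_sum continuous_on_scaleR continuous_on_inner
      continuous_dual continuous_D)

text \<open>\<open>trace_on\<close> picks an unrelated basis at each point. Evaluating the trace on
  the coordinate frame and its dual gives an expression in continuous functions.\<close>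

lemma continuous_shape_trace:
  assumes hyp: "hypersurface M" "positively_oriented M \<xi>"
  shows "continuous_on \<Omega> (\<lambda>u. shape_trace M \<xi> (\<phi> u))"
proof -
  have "shape_trace M \<xi> (\<phi> u) = - (\<Sum>k\<in>UNIV. D\<xi> u (axis k 1) \<bullet> dual (Some k) u)" if u: "u \<in> \<Omega>" for u
  proof -
    obtain h T where sa: "self_adjoint_on (tangent_space M (\<phi> u)) h T"
      and T: "\<And>x. x \<in> tangent_space M (\<phi> u) \<Longrightarrow> T x = shape_operator M \<xi> (\<phi> u) x"
      using self_adjoint_exists[OF hyp u] by metis
    interpret self_adjoint_on "tangent_space M (\<phi> u)" h T by (rule sa)
    obtain B where B: "orthonormal B" "span B = tangent_space M (\<phi> u)"
      using orthonormal_basis_exists[OF subspace_V order_refl] by blast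
    have "shape_trace M \<xi> (\<phi> u) = trace_on (tangent_space M (\<phi> u)) T"
      unfolding shape_trace_def by (rule trace_on_cong) (simp add: T)
    also have "\<dots> = (\<Sum>e\<in>B. h (T e) e)"
      by (rule trace_on_orthonormal[OF B linear_T T_in])
    also have "\<dots> = (\<Sum>k\<in>UNIV. T (D\<phi> u (axis k 1)) \<bullet> dual (Some k) u)"
      by (rule trace_dual_system[OF B linear_T T_in, symmetric])
        (auto simp: tangent_expansion[OF u] tangent_eq[OF u] bounded_linear_inner_left bounded_linear.linear)
    also have "\<dots> = - (\<Sum>k\<in>UNIV. D\<xi> u (axis k 1) \<bullet> dual (Some k) u)"
      using T shape_D\<phi>(1)[OF u] by (simp add: tangent_eq[OF u] sum_negf)
    finally show ?thesis .
  qed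
  moreover have "continuous_on \<Omega> (\<lambda>u. - (\<Sum>k\<in>UNIV. D\<xi> u (axis k 1) \<bullet> dual (Some k) u))"
    by (intro continuous_on_minus continuous_on_sum continuous_on_inner continuous_dual continuous_D)
  ultimately show ?thesis by (simp cong: continuous_on_cong)
qed

text \<open>Individual principal curvatures may be labelled discontinuously; the coefficients of the minimal
  polynomial of the shape operator are symmetric functions of them and depend continuously on the point,
  because a cyclic vector at one point stays cyclic nearby.\<close>

lemma continuous_minimal_polynomial:
  assumes hyp: "hypersurface M" "positively_oriented M \<xi>"
    and lam: "\<And>u. u \<in> \<Omega> \<Longrightarrow> a u \<noteq> b u \<and> a u \<noteq> c u \<and> b u \<noteq> c u"
      "\<And>u. u \<in> \<Omega> \<Longrightarrow> principal_curvatures M \<xi> (\<phi> u) = {a u, b u, c u}"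
  shows "continuous_on \<Omega> (\<lambda>u. a u + b u + c u)"
    "continuous_on \<Omega> (\<lambda>u. a u * b u + a u * c u + b u * c u)"
    "continuous_on \<Omega> (\<lambda>u. a u * b u * c u)"
proof -
  define y :: "real ^ 'n \<Rightarrow> real ^ 3" where
    "y u = vector [a u * b u * c u, - (a u * b u + a u * c u + b u * c u), a u + b u + c u]" for u
  have "isCont y u0" if u0: "u0 \<in> \<Omega>" for u0
  proof -
    define V where "V u = tangent_space M (\<phi> u)" for u
    have ex: "\<exists>h T. three_eigenvalues (V u) h T (a u) (b u) (c u) \<and> (\<forall>x\<in>V u. T x = shape_ext u x)"
      if u: "u \<in> \<Omega>" for u
    proof -
      obtain h T where hT: "three_eigenvalues (V u) h T (a u) (b u) (c u)"
        "\<And>x. x \<in> V u \<Longrightarrow> T x = shape_operator M \<xi> (\<phi> u) x"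
        using three_eigenvalues_exist[OF hyp u, of "a u" "b u" "c u"] lam[OF u] unfolding V_def by metis
      interpret three_eigenvalues "V u" h T "a u" "b u" "c u" by (rule hT)
      show ?thesis
        using hT shape_ext_eq[OF u linear_T] unfolding V_def by blast
    qed
    obtain h0 T0 where T0: "three_eigenvalues (V u0) h0 T0 (a u0) (b u0) (c u0)"
      "\<And>x. x \<in> V u0 \<Longrightarrow> T0 x = shape_ext u0 x"
      using ex[OF u0] by blast
    interpret T0: three_eigenvalues "V u0" h0 T0 "a u0" "b u0" "c u0" by (rule T0)
    obtain x where x: "x \<in> V u0"
      "\<And>p q r. p *\<^sub>R x + q *\<^sub>R T0 x + r *\<^sub>R T0 (T0 x) = 0 \<Longrightarrow> p = 0 \<and> q = 0 \<and> r = 0"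
      using T0.cyclic_vector by blast
    obtain w where w: "x = D\<phi> u0 w" using x(1) unfolding V_def tangent_eq[OF u0] by blast
    \<comment> \<open>The cyclic vector is continued with constant coordinates \<open>w\<close>. The
      cubic relation then writes \<open>z 3\<close> in terms of \<open>z 0\<close>,
      \<open>z 1\<close>, \<open>z 2\<close> with coefficients \<open>y\<close>, and at
      \<open>u0\<close> these three are independent.\<close>
    define z where "z k u = (shape_ext u ^^ k) (D\<phi> u w)" for k :: nat and u
    have z_cont: "continuous_on \<Omega> (z k)" for k
      by (induction k) (auto simp: z_def[abs_def] continuous_D intro!: continuous_shape_ext)
    have z0: "z 0 u0 = x" "z 1 u0 = T0 x" "z 2 u0 = T0 (T0 x)"
      using T0(2) x(1) T0.T_in by (simp_all add: z_def w[symmetric] eval_nat_numeral)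
    have rec: "z 3 u = (a u + b u + c u) *\<^sub>R z 2 u + (- (a u * b u + a u * c u + b u * c u)) *\<^sub>R z 1 u
        + (a u * b u * c u) *\<^sub>R z 0 u" if u: "u \<in> \<Omega>" for u
    proof -
      obtain h T where hT: "three_eigenvalues (V u) h T (a u) (b u) (c u)"
        "\<And>x. x \<in> V u \<Longrightarrow> T x = shape_ext u x"
        using ex[OF u] by blast
      interpret three_eigenvalues "V u" h T "a u" "b u" "c u" by (rule hT)
      have "D\<phi> u w \<in> V u" by (simp add: V_def tangent_eq[OF u])
      from cubic[OF this] this T_in hT(2) show ?thesis
        by (simp add: z_def eval_nat_numeral) (simp add: algebra_simps)
    qed
    define C :: "3 \<Rightarrow> real ^ 'n \<Rightarrow> real ^ ('n option)" where
      "C j = (if j = 1 then z 0 else if j = 2 then z 1 else z 2)" for j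
    show ?thesis
    proof (rule continuous_coefficients[OF open_\<Omega> u0, of C "z 3"])
      show "continuous_on \<Omega> (C j)" for j by (simp add: C_def z_cont)
      show "v = 0" if "(\<Sum>j\<in>UNIV. v $ j *\<^sub>R C j u0) = 0" for v
      proof -
        have "v $ 1 *\<^sub>R x + v $ 2 *\<^sub>R T0 x + v $ 3 *\<^sub>R T0 (T0 x) = 0"
          using that by (simp add: sum_3 C_def z0 del: One_nat_def)
        from x(2)[OF this] show ?thesis by (simp add: vec_eq_iff forall_3)
      qed
      show "(\<Sum>j\<in>UNIV. y u $ j *\<^sub>R C j u) = z 3 u" if "u \<in> \<Omega>" for u
        using rec[OF that] by (simp add: sum_3 C_def y_def vector_3)
    qed (rule z_cont)
  qed
  then have "continuous_on \<Omega> y"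
    using open_\<Omega> by (simp add: continuous_on_eq_continuous_at)
  then have y: "continuous_on \<Omega> (\<lambda>u. y u $ i)" for i
    by (intro continuous_intros)
  show "continuous_on \<Omega> (\<lambda>u. a u + b u + c u)" "continuous_on \<Omega> (\<lambda>u. a u * b u * c u)"
    using y[of 3] y[of 1] by (simp_all add: y_def vector_3)
  show "continuous_on \<Omega> (\<lambda>u. a u * b u + a u * c u + b u * c u)"
    using continuous_on_minus[OF y[of 2]] by (simp add: y_def vector_3 algebra_simps)
qed

lemma openin_image:
  assumes "open W" "W \<subseteq> \<Omega>"
  shows "openin (top_of_set M) (\<phi> ` W)"
proof -
  obtain \<psi> where \<psi>: "homeomorphism \<Omega> (\<phi> ` \<Omega>) \<phi> \<psi>"
    using param unfolding local_param_def by blast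
  have "openin (top_of_set (\<phi> ` \<Omega>)) (\<phi> ` W)"
    using homeomorphism_imp_open_map[OF \<psi>] assms by (simp add: open_subset)
  then show ?thesis
    using param_facts(5) by (rule openin_trans)
qed

end

text \<open>Transfers the algebra of \<open>T\<close> to the tensors of \<open>M\<close> at one
  point; a parametrization around \<open>x\<close> serves only to supply \<open>h\<close> and
  \<open>T\<close>. Multiplicities enter solely through the trace.\<close>

lemma three_principal_curvatures_pointwise:
  fixes a b c \<alpha> \<beta> \<gamma> \<tau> \<mu> :: real
  assumes M: "hypersurface M" "affine_normal M \<xi>" "positively_oriented M \<xi>" and x: "x \<in> M"
    and lam: "a \<noteq> b" "a \<noteq> c" "b \<noteq> c" "principal_curvatures M \<xi> x = {a, b, c}"
    and abc: "\<alpha> = a + b + c" "\<beta> = - a * (b + c) - b * c" "\<gamma> = a * b * c"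
    and \<tau>: "\<tau> = shape_trace M \<xi> x"
    and \<mu>: "\<mu> = \<gamma> + (\<alpha> - \<tau>) * (\<beta> + \<tau> * (\<alpha> - \<tau>))"
  shows "\<And>X Y. X \<in> tangent_space M x \<Longrightarrow> Y \<in> tangent_space M x \<Longrightarrow>
      Ric_star_square M \<xi> x X Y + ((\<alpha> - \<tau>)\<^sup>2 + \<beta>) * Ric_star M \<xi> x X Y
        - \<gamma> * (\<alpha> - 2 * \<tau>) * blaschke_metric M \<xi> x X Y = \<mu> * shape_form M \<xi> x X Y"
    and "\<tau> = a * curvature_multiplicity M \<xi> x a + b * curvature_multiplicity M \<xi> x b
      + c * curvature_multiplicity M \<xi> x c"
proof -
  obtain \<Omega> \<phi> u where p: "local_param M \<Omega> \<phi>" "u \<in> \<Omega>" "x = \<phi> u"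
    using M(1) x unfolding hypersurface_def by blast
  interpret normal_chart M \<xi> \<Omega> \<phi>
    using p(1) M(2) by unfold_locales
  define V where "V = tangent_space M x"
  obtain h T where hT: "three_eigenvalues V h T a b c"
    and T: "\<And>z. z \<in> V \<Longrightarrow> shape_operator M \<xi> x z = T z"
    and h: "\<And>z y. z \<in> V \<Longrightarrow> y \<in> V \<Longrightarrow> blaschke_metric M \<xi> x z y = h z y"
    using three_eigenvalues_exist[OF M(1,3) p(2) lam(1-3)] lam(4) unfolding p(3) V_def by metis
  interpret three_eigenvalues V h T a b c by (rule hT)
  have trace: "\<tau> = trace_on V T"
    unfolding \<tau> shape_trace_def V_def[symmetric] by (rule trace_on_cong) (rule T)
  have S: "shape_form M \<xi> x X Y = h X (T Y)" if "X \<in> V" "Y \<in> V" for X Y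
    using that by (simp add: shape_form_def T T_in h)
  have "R_star M \<xi> x = (\<lambda>X1 X2 X3 X4. 1 / 2 * kulkarni_nomizu (shape_form M \<xi> x) (shape_form M \<xi> x) X1 X2 X3 X4)"
    by (intro ext) (simp add: R_star_def)
  then have Ric: "Ric_star M \<xi> x X Y = h (ricci_endo X) Y" if "X \<in> V" "Y \<in> V" for X Y
    unfolding Ric_star_def V_def[symmetric] using h S that by (simp only: ricci_on_kulkarni_nomizu)
  have Ric2: "Ric_star_square M \<xi> x X Y = h (ricci_endo (ricci_endo X)) Y" if "X \<in> V" "Y \<in> V" for X Y
    unfolding Ric_star_square_def V_def[symmetric]
    using tensor_square_on_endo[OF h Ric ricci_endo_in that] .
  show "Ric_star_square M \<xi> x X Y + ((\<alpha> - \<tau>)\<^sup>2 + \<beta>) * Ric_star M \<xi> x X Y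
      - \<gamma> * (\<alpha> - 2 * \<tau>) * blaschke_metric M \<xi> x X Y = \<mu> * shape_form M \<xi> x X Y"
    if "X \<in> tangent_space M x" "Y \<in> tangent_space M x" for X Y
  proof -
    have XY: "X \<in> V" "Y \<in> V" using that by (simp_all add: V_def)
    have "\<beta> = - (a * b + a * c + b * c)" by (simp add: abc algebra_simps)
    then show ?thesis
      using ricci_endo_square[OF XY trace abc(1) _ abc(3), of \<beta>] XY adj[OF XY]
      by (simp add: Ric Ric2 S h \<mu>)
  qed
  have "curvature_multiplicity M \<xi> x l = dim (eigenspace l)" for l
    unfolding curvature_multiplicity_def V_def[symmetric] using T by (metis (no_types, lifting))
  then show "\<tau> = a * curvature_multiplicity M \<xi> x a + b * curvature_multiplicity M \<xi> x b
      + c * curvature_multiplicity M \<xi> x c"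
    using trace_eigenvalues trace by simp
qed

theorem theorem7p3:
  fixes M :: "(real ^ ('n::finite option)) set"
    and \<xi> :: "real ^ ('n option) \<Rightarrow> real ^ ('n option)"
    and lam0 lam1 lam2 \<alpha> \<beta> \<gamma> \<mu> :: "real ^ ('n option) \<Rightarrow> real"
    and A :: "real ^ ('n option) \<Rightarrow> real ^ ('n option) \<Rightarrow> real ^ ('n option) \<Rightarrow> real"
    and n1 n2 :: nat
  assumes "CARD('n) \<ge> 3"
    and "hypersurface M"
    and "locally_strongly_convex M"
    and "affine_normal M \<xi>"
    and "positively_oriented M \<xi>"
    and "\<And>x. x \<in> M \<Longrightarrow> lam0 x \<noteq> lam1 x \<and> lam0 x \<noteq> lam2 x \<and> lam1 x \<noteq> lam2 x"
    and "\<And>x. x \<in> M \<Longrightarrow> principal_curvatures M \<xi> x = {lam0 x, lam1 x, lam2 x}"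
    and "\<And>x. x \<in> M \<Longrightarrow> curvature_multiplicity M \<xi> x (lam0 x) = 1"
    and "\<And>x. x \<in> M \<Longrightarrow> curvature_multiplicity M \<xi> x (lam1 x) = n1"
    and "\<And>x. x \<in> M \<Longrightarrow> curvature_multiplicity M \<xi> x (lam2 x) = n2"
    and "\<And>x. \<alpha> x = lam0 x + lam1 x + lam2 x"
    and "\<And>x. \<beta> x = - lam0 x * (lam1 x + lam2 x) - lam1 x * lam2 x"
    and "\<And>x. \<gamma> x = lam0 x * lam1 x * lam2 x"
    and "\<And>x X Y. A x X Y =
           Ric_star_square M \<xi> x X Y
           + ((\<alpha> x - shape_trace M \<xi> x)\<^sup>2 + \<beta> x) * Ric_star M \<xi> x X Y
           - \<gamma> x * (\<alpha> x - 2 * shape_trace M \<xi> x) * blaschke_metric M \<xi> x X Y"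
    and "\<And>x. \<mu> x =
           \<gamma> x + (\<alpha> x - shape_trace M \<xi> x)
                 * (\<beta> x + shape_trace M \<xi> x * (\<alpha> x - shape_trace M \<xi> x))"
  shows "(\<forall>x\<in>M. \<forall>X\<in>tangent_space M x. \<forall>Y\<in>tangent_space M x. A x X Y = \<mu> x * shape_form M \<xi> x X Y)
    \<and> (\<forall>x\<in>M. \<mu> x =
         (lam0 x + (real n1 - 1) * lam1 x + (real n2 - 1) * lam2 x)
         * (lam1 x * lam2 x
            + (real n1 * lam1 x + real n2 * lam2 x)
              * ((real n1 - 1) * lam1 x + (real n2 - 1) * lam2 x)))
    \<and> (\<forall>x\<in>M. \<mu> x = 0 \<longrightarrow> affine_partially_Einstein_star_at M \<xi> x)
    \<and> (\<forall>x\<in>M. \<mu> x \<noteq> 0 \<longrightarrow>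
         (\<exists>U. openin (top_of_set M) U \<and> x \<in> U \<and>
            (\<forall>y\<in>U. \<mu> y \<noteq> 0 \<and>
              (\<forall>X1\<in>tangent_space M y. \<forall>X2\<in>tangent_space M y.
               \<forall>X3\<in>tangent_space M y. \<forall>X4\<in>tangent_space M y.
                 R_star M \<xi> y X1 X2 X3 X4
                 = 1 / (2 * (\<mu> y)\<^sup>2) * kulkarni_nomizu (A y) (A y) X1 X2 X3 X4))))"
proof (intro conjI ballI impI)
  note M = assms(2,4,5)
  have distinct: "lam0 x \<noteq> lam1 x" "lam0 x \<noteq> lam2 x" "lam1 x \<noteq> lam2 x" if "x \<in> M" for x
    using assms(6)[OF that] by auto
  note pointwise = three_principal_curvatures_pointwise[OF M _ distinct assms(7) assms(11-13) refl assms(15)]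
  have A: "A x X Y = \<mu> x * shape_form M \<xi> x X Y"
    if "x \<in> M" "X \<in> tangent_space M x" "Y \<in> tangent_space M x" for x X Y
    unfolding assms(14) using that by (intro pointwise(1))
  then show "A x X Y = \<mu> x * shape_form M \<xi> x X Y"
    if "x \<in> M" "X \<in> tangent_space M x" "Y \<in> tangent_space M x" for x X Y
    using that .
  show "\<mu> x = (lam0 x + (real n1 - 1) * lam1 x + (real n2 - 1) * lam2 x)
      * (lam1 x * lam2 x + (real n1 * lam1 x + real n2 * lam2 x)
        * ((real n1 - 1) * lam1 x + (real n2 - 1) * lam2 x))" if x: "x \<in> M" for x
  proof -
    have "shape_trace M \<xi> x = lam0 x + real n1 * lam1 x + real n2 * lam2 x"
      using pointwise(2)[OF x x x x x] assms(8-10)[OF x] by simp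
    \<comment> \<open>With s = (n1 - 1) \<lambda>1 + (n2 - 1) \<lambda>2 one has \<alpha> - \<tau> =
      - s and n1 \<lambda>1 + n2 \<lambda>2 = s + \<lambda>1 + \<lambda>2, after which both sides
      agree as polynomials.\<close>
    then show ?thesis
      unfolding assms(11-13,15) by (simp add: algebra_simps)
  qed
  show "affine_partially_Einstein_star_at M \<xi> x" if x: "x \<in> M" and "\<mu> x = 0" for x
    unfolding affine_partially_Einstein_star_at_def
  proof (intro exI ballI)
    fix X Y assume "X \<in> tangent_space M x" "Y \<in> tangent_space M x"
    then have "A x X Y = 0" using A[OF x] \<open>\<mu> x = 0\<close> by simp
    then show "Ric_star_square M \<xi> x X Y = - ((\<alpha> x - shape_trace M \<xi> x)\<^sup>2 + \<beta> x) * Ric_star M \<xi> x X Y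
        + (\<gamma> x * (\<alpha> x - 2 * shape_trace M \<xi> x)) * blaschke_metric M \<xi> x X Y"
      unfolding assms(14) by (simp add: algebra_simps)
  qed
  show "\<exists>U. openin (top_of_set M) U \<and> x \<in> U \<and> (\<forall>y\<in>U. \<mu> y \<noteq> 0 \<and>
      (\<forall>X1\<in>tangent_space M y. \<forall>X2\<in>tangent_space M y. \<forall>X3\<in>tangent_space M y. \<forall>X4\<in>tangent_space M y.
        R_star M \<xi> y X1 X2 X3 X4 = 1 / (2 * (\<mu> y)\<^sup>2) * kulkarni_nomizu (A y) (A y) X1 X2 X3 X4))"
    if x: "x \<in> M" and ne: "\<mu> x \<noteq> 0" for x
  proof -
    obtain \<Omega> \<phi> u where p: "local_param M \<Omega> \<phi>" "u \<in> \<Omega>" "x = \<phi> u"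
      using M(1) x unfolding hypersurface_def by blast
    interpret normal_chart M \<xi> \<Omega> \<phi>
      using p(1) M(2) by unfold_locales
    have lam: "lam0 (\<phi> v) \<noteq> lam1 (\<phi> v) \<and> lam0 (\<phi> v) \<noteq> lam2 (\<phi> v) \<and> lam1 (\<phi> v) \<noteq> lam2 (\<phi> v)"
      "principal_curvatures M \<xi> (\<phi> v) = {lam0 (\<phi> v), lam1 (\<phi> v), lam2 (\<phi> v)}" if "v \<in> \<Omega>" for v
      using assms(6,7) param_facts(4)[OF that] by auto
    note cont = continuous_minimal_polynomial[OF M(1,3) lam]
    \<comment> \<open>\<beta> is minus the second elementary symmetric function of the principal
      curvatures.\<close>
    have "continuous_on \<Omega> (\<lambda>v. \<beta> (\<phi> v))"
      using continuous_on_minus[OF cont(2)] by (simp add: assms(12) algebra_simps)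
    moreover have "continuous_on \<Omega> (\<lambda>v. \<alpha> (\<phi> v))" "continuous_on \<Omega> (\<lambda>v. \<gamma> (\<phi> v))"
      using cont(1,3) by (simp_all add: assms(11,13))
    ultimately have "continuous_on \<Omega> (\<lambda>v. \<mu> (\<phi> v))"
      unfolding assms(15)
      by (intro continuous_on_add continuous_on_mult continuous_on_diff continuous_shape_trace M)
    then have "open (\<Omega> \<inter> (\<lambda>v. \<mu> (\<phi> v)) -` (- {0}))"
      by (rule continuous_open_preimage) (auto simp: open_\<Omega>)
    then have U: "openin (top_of_set M) (\<phi> ` (\<Omega> \<inter> (\<lambda>v. \<mu> (\<phi> v)) -` (- {0})))" (is "openin _ ?U")
      by (rule openin_image) auto
    have "x \<in> ?U" using p ne by auto
    have R: "\<mu> y \<noteq> 0 \<and> (\<forall>X1\<in>tangent_space M y. \<forall>X2\<in>tangent_space M y. \<forall>X3\<in>tangent_space M y.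
        \<forall>X4\<in>tangent_space M y.
        R_star M \<xi> y X1 X2 X3 X4 = 1 / (2 * (\<mu> y)\<^sup>2) * kulkarni_nomizu (A y) (A y) X1 X2 X3 X4)"
      if y: "y \<in> ?U" for y
    proof (intro conjI ballI)
      show ne: "\<mu> y \<noteq> 0" using y by auto
      have "y \<in> M" using y param_facts(4) by auto
      note Ay = A[OF this]
      fix X1 X2 X3 X4
      assume X: "X1 \<in> tangent_space M y" "X2 \<in> tangent_space M y" "X3 \<in> tangent_space M y"
        "X4 \<in> tangent_space M y"
      \<comment> \<open>The product is bilinear in its two tensors, so the factor \<mu> comes out
        squared.\<close>
      have "kulkarni_nomizu (A y) (A y) X1 X2 X3 X4
          = (\<mu> y)\<^sup>2 * kulkarni_nomizu (shape_form M \<xi> y) (shape_form M \<xi> y) X1 X2 X3 X4"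
        using X by (simp add: kulkarni_nomizu_def Ay) (simp add: power2_eq_square algebra_simps)
      then show "R_star M \<xi> y X1 X2 X3 X4
          = 1 / (2 * (\<mu> y)\<^sup>2) * kulkarni_nomizu (A y) (A y) X1 X2 X3 X4"
        using ne by (simp add: R_star_def)
    qed
    show ?thesis
      by (intro exI[of _ ?U] conjI U \<open>x \<in> ?U\<close>) (rule ballI, rule R)
  qed
qed

end
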